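(* Let $m>1$. If a pure, co-spherically contractive Hilbert module $\mathcal{M}$ over $\mathbb{C}[z_1,\dots,z_m]$ possesses a finite inner resolution, then $\mathcal{M}$ is isometrically isomorphic to $H^2_m\otimes\mathcal{F}$ for some Hilbert space $\mathcal{F}$.
   Context: A Hilbert module over $\mathbb{C}[z_1,\dots,z_m]$ is a Hilbert space $\mathcal{M}$ with a commuting $m$-tuple of bounded operators $M_1,\dots,M_m$ giving multiplication by $z_1,\dots,z_m$. It is co-spherically contractive if $\sum_i M_iM_i^*\le I$; then with $P(A)=\sum_i M_iAM_i^*$ the sequence $P^l(I)$ decreases, and $\mathcal{M}$ is pure if $P^l(I)\to0$ in the strong operator topology as $l\to\infty$. A module map is a bounded operator commuting with the module actions; isometrically isomorphic means there is a unitary module map. The Drury-Arveson (DA) module $H^2_m$ is the reproducing kernel Hilbert space on the open unit ball $\mathbb{B}^m\subset\mathbb{C}^m$ with kernel $(1-\sum_{i=1}^m z_i\bar w_i)^{-1}$. For a Hilbert space $\mathcal{E}$, $H^2_m\otimes\mathcal{E}$ is identified with the Hilbert space of $\mathcal{E}$-valued holomorphic functions $f(z)=\sum_{\bm{k}\in\mathbb{N}^m}a_{\bm{k}}z^{\bm{k}}$ on $\mathbb{B}^m$ with $\|f\|^2=\sum_{\bm{k}}\|a_{\bm{k}}\|^2\frac{k_1!\cdots k_m!}{(k_1+\cdots+k_m)!}<\infty$, a Hilbert module with $z_i$ acting by multiplication by the coordinate function. A multiplier $\varphi\in\mathcal{M}(\mathcal{E},\mathcal{E}_* )$ is a holomorphic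 function $\varphi:\mathbb{B}^m\to\mathcal{L}(\mathcal{E},\mathcal{E}_* )$ with $\varphi f\in H^2_m\otimes\mathcal{E}_*$ for all $f\in H^2_m\otimes\mathcal{E}$; $M_\varphi f=\varphi f$ is the associated bounded module map. $\varphi$ is inner if $M_\varphi$ is a partial isometry. A finite inner resolution (of length $N$, $1\le N<\infty$) of a pure co-spherically contractive Hilbert module $\mathcal{M}$ consists of Hilbert spaces $\mathcal{E}_0,\dots,\mathcal{E}_N$, inner multipliers $\varphi_k\in\mathcal{M}(\mathcal{E}_k,\mathcal{E}_{k-1})$ with $X_k=M_{\varphi_k}$ for $k=1,\dots,N$, and a co-isometric module map $X_0:H^2_m\otimes\mathcal{E}_0\to\mathcal{M}$, such that the sequence $$0\to H^2_m\otimes\mathcal{E}_N\xrightarrow{X_N}H^2_m\otimes\mathcal{E}_{N-1}\to\cdots\to H^2_m\otimes\mathcal{E}_1\xrightarrow{X_1}H^2_m\otimes\mathcal{E}_0\xrightarrow{X_0}\mathcal{M}\to0$$ is exact, i.e. $\operatorname{ran}X_k=\ker X_{k-1}$ for $k=1,\dots,N$ and $\ker X_N=\{0\}$. *)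

theory Defs
  imports "HOL-Analysis.Analysis" "HOL-Library.Function_Algebras"
begin

section \<open>Complex vector spaces\<close>

class complex_vector = ab_group_add +
  fixes scaleC :: "complex \<Rightarrow> 'a \<Rightarrow> 'a" (infixr "*\<^sub>C" 75)
  assumes scaleC_add_right: "c *\<^sub>C (x + y) = c *\<^sub>C x + c *\<^sub>C y"
    and scaleC_add_left: "(c + d) *\<^sub>C x = c *\<^sub>C x + d *\<^sub>C x"
    and scaleC_scaleC: "c *\<^sub>C d *\<^sub>C x = (c * d) *\<^sub>C x"
    and scaleC_one: "1 *\<^sub>C x = x"

interpretation complex_vector: vector_space "scaleC :: complex \<Rightarrow> 'a \<Rightarrow> 'a :: complex_vector"
  by unfold_locales (simp_all add: scaleC_add_right scaleC_add_left scaleC_scaleC scaleC_one)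

instantiation "fun" :: (type, complex_vector) complex_vector
begin

definition scaleC_fun :: "complex \<Rightarrow> ('a \<Rightarrow> 'b) \<Rightarrow> 'a \<Rightarrow> 'b"
  where "scaleC_fun c f = (\<lambda>x. c *\<^sub>C f x)"

instance
  by standard
    (simp_all add: scaleC_fun_def fun_eq_iff scaleC_add_right scaleC_add_left
      scaleC_scaleC scaleC_one)

end


section \<open>Hilbert spaces and their operators\<close>

text \<open>A Hilbert space is a linear subspace of some complex vector space, with an inner product
  for which it is complete. No topology or inner product on the surrounding type is involved: the
  type only provides the elements and their linear structure, so that a sequence of unrelated
  Hilbert spaces can be indexed by natural numbers. Inner products are linear in the first
  argument, and operators matter only on the carrier of their domain.\<close>

record 'a hspace =
  hcarrier :: "'a set"
  hinner :: "'a \<Rightarrow> 'a \<Rightarrow> complex"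

definition hnorm :: "('a, 'x) hspace_scheme \<Rightarrow> 'a \<Rightarrow> real"
  where "hnorm H x = sqrt (Re (hinner H x x))"

definition hilbert_space :: "('a :: complex_vector, 'x) hspace_scheme \<Rightarrow> bool"
  where "hilbert_space H \<longleftrightarrow>
    complex_vector.subspace (hcarrier H) \<and>
    (\<forall>x\<in>hcarrier H. \<forall>y\<in>hcarrier H. \<forall>z\<in>hcarrier H.
      hinner H (x + y) z = hinner H x z + hinner H y z) \<and>
    (\<forall>c. \<forall>x\<in>hcarrier H. \<forall>y\<in>hcarrier H. hinner H (c *\<^sub>C x) y = c * hinner H x y) \<and>
    (\<forall>x\<in>hcarrier H. \<forall>y\<in>hcarrier H. hinner H y x = cnj (hinner H x y)) \<and>
    (\<forall>x\<in>hcarrier H. x \<noteq> 0 \<longrightarrow> 0 < Re (hinner H x x)) \<and>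
    (\<forall>s :: nat \<Rightarrow> 'a. (\<forall>n. s n \<in> hcarrier H) \<and>
        (\<forall>e>0. \<exists>n0. \<forall>m\<ge>n0. \<forall>n\<ge>n0. hnorm H (s m - s n) < e) \<longrightarrow>
      (\<exists>l\<in>hcarrier H. (\<lambda>n. hnorm H (s n - l)) \<longlonglongrightarrow> 0))"

definition bounded_op ::
    "('a :: complex_vector, 'x) hspace_scheme \<Rightarrow> ('b :: complex_vector, 'y) hspace_scheme \<Rightarrow>
      ('a \<Rightarrow> 'b) \<Rightarrow> bool"
  where "bounded_op H K T \<longleftrightarrow>
    (\<forall>x\<in>hcarrier H. T x \<in> hcarrier K) \<and>
    (\<forall>x\<in>hcarrier H. \<forall>y\<in>hcarrier H. T (x + y) = T x + T y) \<and>
    (\<forall>c. \<forall>x\<in>hcarrier H. T (c *\<^sub>C x) = c *\<^sub>C T x) \<and>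
    (\<exists>B. \<forall>x\<in>hcarrier H. hnorm K (T x) \<le> B * hnorm H x)"

definition hker :: "('a, 'x) hspace_scheme \<Rightarrow> ('a \<Rightarrow> 'b :: zero) \<Rightarrow> 'a set"
  where "hker H T = {x \<in> hcarrier H. T x = 0}"

definition hran :: "('a, 'x) hspace_scheme \<Rightarrow> ('a \<Rightarrow> 'b) \<Rightarrow> 'b set"
  where "hran H T = T ` hcarrier H"

text \<open>A bounded operator between Hilbert spaces has exactly one adjoint, up to values outside the
  carrier.\<close>

definition has_adjoint ::
    "('a, 'x) hspace_scheme \<Rightarrow> ('b, 'y) hspace_scheme \<Rightarrow> ('a \<Rightarrow> 'b) \<Rightarrow> ('b \<Rightarrow> 'a) \<Rightarrow> bool"
  where "has_adjoint H K T S \<longleftrightarrow>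
    (\<forall>y\<in>hcarrier K. S y \<in> hcarrier H) \<and>
    (\<forall>x\<in>hcarrier H. \<forall>y\<in>hcarrier K. hinner K (T x) y = hinner H x (S y))"

definition adjoint_op ::
    "('a, 'x) hspace_scheme \<Rightarrow> ('b, 'y) hspace_scheme \<Rightarrow> ('a \<Rightarrow> 'b) \<Rightarrow> 'b \<Rightarrow> 'a"
  where "adjoint_op H K T = (SOME S. has_adjoint H K T S)"

definition op_le :: "('a :: minus, 'x) hspace_scheme \<Rightarrow> ('a \<Rightarrow> 'a) \<Rightarrow> ('a \<Rightarrow> 'a) \<Rightarrow> bool"
  where "op_le H A B \<longleftrightarrow> (\<forall>x\<in>hcarrier H. hinner H (B x - A x) x \<in> \<real>\<^sub>\<ge>\<^sub>0)"

definition partial_isometry ::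
    "('a :: complex_vector, 'x) hspace_scheme \<Rightarrow> ('b :: complex_vector, 'y) hspace_scheme \<Rightarrow>
      ('a \<Rightarrow> 'b) \<Rightarrow> bool"
  where "partial_isometry H K T \<longleftrightarrow> bounded_op H K T \<and>
    (\<forall>x\<in>hcarrier H. (\<forall>y\<in>hker H T. hinner H x y = 0) \<longrightarrow> hnorm K (T x) = hnorm H x)"

text \<open>\<open>T\<close> is co-isometric if the product of \<open>T\<close> with its adjoint is the identity.\<close>

definition co_isometry ::
    "('a :: complex_vector, 'x) hspace_scheme \<Rightarrow> ('b :: complex_vector, 'y) hspace_scheme \<Rightarrow>
      ('a \<Rightarrow> 'b) \<Rightarrow> bool"
  where "co_isometry H K T \<longleftrightarrow> bounded_op H K T \<and>
    (\<exists>S. has_adjoint H K T S \<and> (\<forall>y\<in>hcarrier K. T (S y) = y))"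

definition unitary_op ::
    "('a :: complex_vector, 'x) hspace_scheme \<Rightarrow> ('b :: complex_vector, 'y) hspace_scheme \<Rightarrow>
      ('a \<Rightarrow> 'b) \<Rightarrow> bool"
  where "unitary_op H K T \<longleftrightarrow> bounded_op H K T \<and> hran H T = hcarrier K \<and>
    (\<forall>x\<in>hcarrier H. \<forall>y\<in>hcarrier H. hinner K (T x) (T y) = hinner H x y)"


section \<open>Hilbert modules\<close>

text \<open>\<open>'m\<close> is the index type of the variables, so the number of variables is \<open>CARD('m)\<close>, and
  \<open>act M i\<close> is multiplication by the \<open>i\<close>-th variable.\<close>

record ('a, 'm) hmodule = "'a hspace" +
  act :: "'m \<Rightarrow> 'a \<Rightarrow> 'a"

definition hilbert_module :: "('a :: complex_vector, 'm :: finite) hmodule \<Rightarrow> bool"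
  where "hilbert_module M \<longleftrightarrow> hilbert_space M \<and> (\<forall>i. bounded_op M M (act M i)) \<and>
    (\<forall>i j. \<forall>x\<in>hcarrier M. act M i (act M j x) = act M j (act M i x))"

definition cp_map :: "('a :: complex_vector, 'm :: finite) hmodule \<Rightarrow> ('a \<Rightarrow> 'a) \<Rightarrow> 'a \<Rightarrow> 'a"
  where "cp_map M A = (\<lambda>x. \<Sum>i\<in>UNIV. act M i (A (adjoint_op M M (act M i) x)))"

definition co_spherically_contractive :: "('a :: complex_vector, 'm :: finite) hmodule \<Rightarrow> bool"
  where "co_spherically_contractive M \<longleftrightarrow>
    op_le M (\<lambda>x. \<Sum>i\<in>UNIV. act M i (adjoint_op M M (act M i) x)) id"

definition pure_module :: "('a :: complex_vector, 'm :: finite) hmodule \<Rightarrow> bool"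
  where "pure_module M \<longleftrightarrow>
    (\<forall>x\<in>hcarrier M. (\<lambda>l. hnorm M ((cp_map M ^^ l) id x)) \<longlonglongrightarrow> 0)"

definition module_map ::
    "('a :: complex_vector, 'm :: finite) hmodule \<Rightarrow> ('b :: complex_vector, 'm) hmodule \<Rightarrow>
      ('a \<Rightarrow> 'b) \<Rightarrow> bool"
  where "module_map M N T \<longleftrightarrow> bounded_op M N T \<and>
    (\<forall>i. \<forall>x\<in>hcarrier M. T (act M i x) = act N i (T x))"

definition isometrically_isomorphic ::
    "('a :: complex_vector, 'm :: finite) hmodule \<Rightarrow> ('b :: complex_vector, 'm) hmodule \<Rightarrow> bool"
  where "isometrically_isomorphic M N \<longleftrightarrow> (\<exists>U. module_map M N U \<and> unitary_op M N U)"


section \<open>The vector-valued Drury-Arveson module\<close>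

definition monomial :: "complex ^ 'm \<Rightarrow> ('m :: finite \<Rightarrow> nat) \<Rightarrow> complex"
  where "monomial z k = (\<Prod>i\<in>UNIV. (z $ i) ^ k i)"

definition DA_weight :: "('m :: finite \<Rightarrow> nat) \<Rightarrow> real"
  where "DA_weight k = (\<Prod>i\<in>UNIV. fact (k i)) / fact (\<Sum>i\<in>UNIV. k i)"

text \<open>The unordered power series over all multi-indices with coefficients \<open>a k\<close> in \<open>E\<close> converges
  to \<open>f\<close> in the norm of \<open>E\<close> at every point of the open unit ball of \<open>complex ^ 'm\<close>.\<close>

definition has_power_series ::
    "('e :: complex_vector, 'x) hspace_scheme \<Rightarrow> (complex ^ 'm :: finite \<Rightarrow> 'e) \<Rightarrow>
      (('m \<Rightarrow> nat) \<Rightarrow> 'e) \<Rightarrow> bool"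
  where "has_power_series E f a \<longleftrightarrow> (\<forall>k. a k \<in> hcarrier E) \<and>
    (\<forall>z\<in>ball 0 1. f z \<in> hcarrier E \<and>
      ((\<lambda>K. hnorm E ((\<Sum>k\<in>K. monomial z k *\<^sub>C a k) - f z)) \<longlongrightarrow> 0)
        (finite_subsets_at_top UNIV))"

text \<open>The coefficients of a convergent power series are determined by its sum.\<close>

definition taylor_coeff ::
    "('e :: complex_vector, 'x) hspace_scheme \<Rightarrow> (complex ^ 'm :: finite \<Rightarrow> 'e) \<Rightarrow>
      ('m \<Rightarrow> nat) \<Rightarrow> 'e"
  where "taylor_coeff E f = (SOME a. has_power_series E f a)"

text \<open>Functions on the ball are represented by functions on \<open>complex ^ 'm\<close> that vanish outside it.
  The inner product is the polarization of the norm.\<close>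

definition DA_module ::
    "('e :: complex_vector, 'x) hspace_scheme \<Rightarrow> (complex ^ 'm :: finite \<Rightarrow> 'e, 'm) hmodule"
  where "DA_module E = \<lparr>
    hcarrier = {f. (\<forall>z. z \<notin> ball 0 1 \<longrightarrow> f z = 0) \<and>
      (\<exists>a. has_power_series E f a \<and>
        (\<lambda>k. DA_weight k * (hnorm E (a k))\<^sup>2) summable_on UNIV)},
    hinner = (\<lambda>f g. \<Sum>\<^sub>\<infinity>k. of_real (DA_weight k) *
      hinner E (taylor_coeff E f k) (taylor_coeff E g k)),
    act = (\<lambda>i f z. (z $ i) *\<^sub>C f z)\<rparr>"

text \<open>Holomorphy of an operator-valued function: at each point of the ball there is a complex
  Frechet derivative, with partial derivatives \<open>D i\<close>, with respect to the operator norm.\<close>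

definition op_holomorphic ::
    "('e :: complex_vector, 'x) hspace_scheme \<Rightarrow> ('f :: complex_vector, 'y) hspace_scheme \<Rightarrow>
      (complex ^ 'm :: finite \<Rightarrow> 'e \<Rightarrow> 'f) \<Rightarrow> bool"
  where "op_holomorphic E F \<phi> \<longleftrightarrow>
    (\<forall>z\<in>ball 0 1. bounded_op E F (\<phi> z)) \<and>
    (\<forall>z\<in>ball 0 1. \<exists>D. (\<forall>i. bounded_op E F (D i)) \<and>
      (\<forall>\<epsilon>>0. \<forall>\<^sub>F w in at z. \<forall>x\<in>hcarrier E.
        hnorm F (\<phi> w x - \<phi> z x - (\<Sum>i\<in>UNIV. (w $ i - z $ i) *\<^sub>C D i x))
          \<le> \<epsilon> * norm (w - z) * hnorm E x))"

definition mult_op ::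
    "(complex ^ 'm :: finite \<Rightarrow> 'e \<Rightarrow> 'f :: zero) \<Rightarrow> (complex ^ 'm \<Rightarrow> 'e) \<Rightarrow> complex ^ 'm \<Rightarrow> 'f"
  where "mult_op \<phi> f = (\<lambda>z. if z \<in> ball 0 1 then \<phi> z (f z) else 0)"

definition multiplier ::
    "('e :: complex_vector, 'x) hspace_scheme \<Rightarrow> ('f :: complex_vector, 'y) hspace_scheme \<Rightarrow>
      (complex ^ 'm :: finite \<Rightarrow> 'e \<Rightarrow> 'f) \<Rightarrow> bool"
  where "multiplier E F \<phi> \<longleftrightarrow> op_holomorphic E F \<phi> \<and>
    (\<forall>f\<in>hcarrier (DA_module E). mult_op \<phi> f \<in> hcarrier (DA_module F))"

definition inner_multiplier ::
    "('e :: complex_vector, 'x) hspace_scheme \<Rightarrow> ('f :: complex_vector, 'y) hspace_scheme \<Rightarrow>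
      (complex ^ 'm :: finite \<Rightarrow> 'e \<Rightarrow> 'f) \<Rightarrow> bool"
  where "inner_multiplier E F \<phi> \<longleftrightarrow> multiplier E F \<phi> \<and>
    partial_isometry (DA_module E) (DA_module F) (mult_op \<phi>)"


section \<open>Finite inner resolutions\<close>

text \<open>Exactness at the module itself, i.e. surjectivity of \<open>X0\<close>, is part of \<open>X0\<close> being
  co-isometric.\<close>

definition finite_inner_resolution ::
    "('a :: complex_vector, 'm :: finite) hmodule \<Rightarrow> nat \<Rightarrow> (nat \<Rightarrow> 'e :: complex_vector hspace) \<Rightarrow>
      (nat \<Rightarrow> complex ^ 'm \<Rightarrow> 'e \<Rightarrow> 'e) \<Rightarrow> ((complex ^ 'm \<Rightarrow> 'e) \<Rightarrow> 'a) \<Rightarrow> bool"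
  where "finite_inner_resolution M N E \<phi> X0 \<longleftrightarrow>
    1 \<le> N \<and>
    (\<forall>k\<in>{0..N}. hilbert_space (E k)) \<and>
    (\<forall>k\<in>{1..N}. inner_multiplier (E k) (E (k - 1)) (\<phi> k)) \<and>
    module_map (DA_module (E 0)) M X0 \<and>
    co_isometry (DA_module (E 0)) M X0 \<and>
    hran (DA_module (E 1)) (mult_op (\<phi> 1)) = hker (DA_module (E 0)) X0 \<and>
    (\<forall>k\<in>{2..N}. hran (DA_module (E k)) (mult_op (\<phi> k)) =
      hker (DA_module (E (k - 1))) (mult_op (\<phi> (k - 1)))) \<and>
    hker (DA_module (E N)) (mult_op (\<phi> N)) = {0}"

end

theory Submission
  imports Defs
begin

text \<open>Let \<open>\<phi>\<close> be an inner multiplier whose kernel consists of all functions with values in a closed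
  subspace \<open>G\<close> of the coefficient space. For \<open>x\<close> orthogonal to \<open>G\<close>, the constant \<open>x\<close> and all the
  functions \<open>z\<^sub>i x\<close> are orthogonal to the kernel and have norm \<open>\<parallel>x\<parallel>\<close>. Hence \<open>f = \<phi> x\<close> satisfies
  \<open>\<parallel>z\<^sub>i f\<parallel> = \<parallel>f\<parallel>\<close> for every \<open>i\<close>. But multiplication by \<open>z\<^sub>i\<close> changes the squared norm of \<open>z\<^sup>k\<close> by the
  factor \<open>(k\<^sub>i + 1) / (\<bar>k\<bar> + 1) \<le> 1\<close>, with equality only if \<open>k\<close> is supported at \<open>i\<close>. When there are at
  least two variables no \<open>k \<noteq> 0\<close> is supported at every \<open>i\<close>, so \<open>f\<close> is constant
  (\<open>constant_if_acts_isometric\<close>). On constants from \<open>G\<close> the multiplier vanishes, and therefore \<open>\<phi>\<close> is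
  constant in \<open>z\<close>: it is a partial isometry between coefficient spaces
  (\<open>inner_multiplier_constant\<close>), and its range again consists of all functions with values in a
  closed subspace (\<open>inner_multiplier_range\<close>).

  In a finite inner resolution the last kernel is zero, which is of this form. Exactness carries
  the form down to the kernel of \<open>X\<^sub>0\<close> (\<open>finite_inner_resolution_kernel\<close>). A co-isometric module map
  is unitary on the orthogonal complement of its kernel; here this complement consists of the
  functions with values in the orthogonal complement of some \<open>G\<close> in \<open>E\<^sub>0\<close>, which is a
  Drury-Arveson module itself. The required coefficient space \<open>F\<close> is found inside the given module,
  as the image of the constants from that complement (\<open>co_isometry_free\<close>).\<close>

section \<open>Geometry of Hilbert spaces on carriers\<close>

locale hilbert =
  fixes H :: "('a :: complex_vector, 'x) hspace_scheme"
  assumes hilbert_space: "hilbert_space H"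
begin

lemma subspace: "complex_vector.subspace (hcarrier H)"
  using hilbert_space by (simp add: hilbert_space_def)

lemma zero_mem [simp]: "0 \<in> hcarrier H"
  and add_mem: "x \<in> hcarrier H \<Longrightarrow> y \<in> hcarrier H \<Longrightarrow> x + y \<in> hcarrier H"
  and diff_mem: "x \<in> hcarrier H \<Longrightarrow> y \<in> hcarrier H \<Longrightarrow> x - y \<in> hcarrier H"
  and scale_mem: "x \<in> hcarrier H \<Longrightarrow> c *\<^sub>C x \<in> hcarrier H"
  and sum_mem: "(\<And>i. i \<in> A \<Longrightarrow> f i \<in> hcarrier H) \<Longrightarrow> sum f A \<in> hcarrier H"
  using subspace
  by (simp_all add: complex_vector.subspace_0 complex_vector.subspace_add
      complex_vector.subspace_diff complex_vector.subspace_scale complex_vector.subspace_sum)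

lemmas mem = add_mem diff_mem scale_mem sum_mem

lemma inner_add_left:
  "\<lbrakk>x \<in> hcarrier H; y \<in> hcarrier H; z \<in> hcarrier H\<rbrakk> \<Longrightarrow>
    hinner H (x + y) z = hinner H x z + hinner H y z"
  and inner_scale_left:
  "\<lbrakk>x \<in> hcarrier H; y \<in> hcarrier H\<rbrakk> \<Longrightarrow> hinner H (c *\<^sub>C x) y = c * hinner H x y"
  and inner_pos: "\<lbrakk>x \<in> hcarrier H; x \<noteq> 0\<rbrakk> \<Longrightarrow> 0 < Re (hinner H x x)"
  using hilbert_space unfolding hilbert_space_def by blast+

lemma inner_commute:
  "\<lbrakk>x \<in> hcarrier H; y \<in> hcarrier H\<rbrakk> \<Longrightarrow> hinner H y x = cnj (hinner H x y)"
  using hilbert_space unfolding hilbert_space_def by blast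

lemma inner_add_right:
  "\<lbrakk>x \<in> hcarrier H; y \<in> hcarrier H; z \<in> hcarrier H\<rbrakk> \<Longrightarrow>
    hinner H z (x + y) = hinner H z x + hinner H z y"
  using inner_commute[of "x + y" z] inner_commute[of x z] inner_commute[of y z]
  by (simp add: inner_add_left add_mem)

lemma inner_scale_right:
  "\<lbrakk>x \<in> hcarrier H; y \<in> hcarrier H\<rbrakk> \<Longrightarrow> hinner H y (c *\<^sub>C x) = cnj c * hinner H y x"
  using inner_commute[of "c *\<^sub>C x" y] inner_commute[of x y]
  by (simp add: inner_scale_left scale_mem)

lemma inner_zero_left [simp]: "y \<in> hcarrier H \<Longrightarrow> hinner H 0 y = 0"
  using inner_scale_left[of 0 y 0] by simp

lemma inner_zero_right [simp]: "y \<in> hcarrier H \<Longrightarrow> hinner H y 0 = 0"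
  using inner_scale_right[of 0 y 0] by simp

lemma inner_diff_left:
  "\<lbrakk>x \<in> hcarrier H; y \<in> hcarrier H; z \<in> hcarrier H\<rbrakk> \<Longrightarrow>
    hinner H (x - y) z = hinner H x z - hinner H y z"
  using inner_add_left[of "x - y" y z] by (simp add: diff_mem)

lemma inner_diff_right:
  "\<lbrakk>x \<in> hcarrier H; y \<in> hcarrier H; z \<in> hcarrier H\<rbrakk> \<Longrightarrow>
    hinner H z (x - y) = hinner H z x - hinner H z y"
  using inner_add_right[of "x - y" y z] by (simp add: diff_mem)

lemma inner_sum_left:
  "\<lbrakk>\<And>i. i \<in> A \<Longrightarrow> f i \<in> hcarrier H; y \<in> hcarrier H\<rbrakk> \<Longrightarrow>
    hinner H (sum f A) y = (\<Sum>i\<in>A. hinner H (f i) y)"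
  by (induction A rule: infinite_finite_induct) (simp_all add: inner_add_left sum_mem)

lemma inner_self: "x \<in> hcarrier H \<Longrightarrow> hinner H x x = of_real ((hnorm H x)\<^sup>2)"
proof -
  assume x: "x \<in> hcarrier H"
  have "Im (hinner H x x) = 0"
    using arg_cong[OF inner_commute[OF x x], of Im] by simp
  moreover have "0 \<le> Re (hinner H x x)"
    using inner_pos[OF x] x by (cases "x = 0") auto
  ultimately show ?thesis
    by (simp add: hnorm_def complex_eq_iff)
qed

lemma norm_sq: "x \<in> hcarrier H \<Longrightarrow> (hnorm H x)\<^sup>2 = Re (hinner H x x)"
  by (simp add: inner_self)

lemma norm_nonneg [simp]: "x \<in> hcarrier H \<Longrightarrow> 0 \<le> hnorm H x"
  using inner_pos[of x] unfolding hnorm_def by (cases "x = 0") auto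

lemma norm_zero [simp]: "hnorm H 0 = 0"
  by (simp add: hnorm_def)

lemma norm_eq_zero: "x \<in> hcarrier H \<Longrightarrow> hnorm H x = 0 \<longleftrightarrow> x = 0"
  using inner_pos[of x] by (cases "x = 0") (auto simp: hnorm_def)

lemma norm_scale: "x \<in> hcarrier H \<Longrightarrow> hnorm H (c *\<^sub>C x) = cmod c * hnorm H x"
proof -
  assume x: "x \<in> hcarrier H"
  have "hinner H (c *\<^sub>C x) (c *\<^sub>C x) = c * (cnj c * hinner H x x)"
    using x by (simp add: inner_scale_left inner_scale_right scale_mem del: inner_self)
  also have "\<dots> = of_real ((cmod c)\<^sup>2 * (hnorm H x)\<^sup>2)"
    using x by (simp only: inner_self of_real_mult complex_norm_square mult.assoc)
  finally have "(hnorm H (c *\<^sub>C x))\<^sup>2 = (cmod c * hnorm H x)\<^sup>2"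
    using x by (simp add: norm_sq scale_mem power_mult_distrib)
  thus ?thesis
    using x by (simp add: power2_eq_iff_nonneg scale_mem)
qed

text \<open>Subtracting from \<open>x\<close> its component along \<open>y\<close> shortens \<open>x\<close> by exactly that component.
  Both the Cauchy--Schwarz inequality and the orthogonality of nearest points follow.\<close>

lemma norm_sub_component:
  assumes x: "x \<in> hcarrier H" and y: "y \<in> hcarrier H" and "y \<noteq> 0"
  defines "c \<equiv> hinner H x y / of_real ((hnorm H y)\<^sup>2)"
  shows "(hnorm H (x - c *\<^sub>C y))\<^sup>2 = (hnorm H x)\<^sup>2 - (cmod (hinner H x y))\<^sup>2 / (hnorm H y)\<^sup>2"
proof -
  have ny: "hnorm H y \<noteq> 0"
    using assms by (simp add: norm_eq_zero)
  have "hinner H (x - c *\<^sub>C y) (x - c *\<^sub>C y) =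
      hinner H x x - cnj c * hinner H x y - c * (hinner H y x - cnj c * hinner H y y)"
    using x y by (simp add: inner_diff_left inner_diff_right inner_scale_left inner_scale_right
        diff_mem scale_mem algebra_simps)
  also have "cnj c * hinner H y y = hinner H y x"
    using x y ny by (simp add: c_def inner_self inner_commute[OF x y])
  also have "cnj c * hinner H x y = of_real ((cmod (hinner H x y))\<^sup>2 / (hnorm H y)\<^sup>2)"
    by (simp add: c_def complex_norm_square mult.commute del: of_real_power)
  finally have "hinner H (x - c *\<^sub>C y) (x - c *\<^sub>C y) =
      of_real ((hnorm H x)\<^sup>2 - (cmod (hinner H x y))\<^sup>2 / (hnorm H y)\<^sup>2)"
    using x by (simp add: inner_self)
  moreover have "x - c *\<^sub>C y \<in> hcarrier H"
    using x y by (intro mem)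
  ultimately show ?thesis
    by (simp only: norm_sq Re_complex_of_real)
qed

lemma Cauchy_Schwarz:
  assumes x: "x \<in> hcarrier H" and y: "y \<in> hcarrier H"
  shows "cmod (hinner H x y) \<le> hnorm H x * hnorm H y"
proof (cases "y = 0")
  case False
  hence "hnorm H y > 0"
    using y norm_eq_zero[of y] norm_nonneg[of y] by linarith
  moreover have "(cmod (hinner H x y))\<^sup>2 / (hnorm H y)\<^sup>2 \<le> (hnorm H x)\<^sup>2"
    using norm_sub_component[OF x y False] by (smt (verit) zero_le_power2)
  ultimately have "(cmod (hinner H x y))\<^sup>2 \<le> (hnorm H x * hnorm H y)\<^sup>2"
    by (simp add: divide_simps power_mult_distrib)
  thus ?thesis
    using x y by (simp add: power2_le_iff_abs_le)
qed (use x in simp)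

lemma norm_add_sq:
  assumes x: "x \<in> hcarrier H" and y: "y \<in> hcarrier H"
  shows "(hnorm H (x + y))\<^sup>2 = (hnorm H x)\<^sup>2 + 2 * Re (hinner H x y) + (hnorm H y)\<^sup>2"
  using x y inner_commute[OF x y] by (simp add: norm_sq mem inner_add_left inner_add_right)

lemma norm_diff_sq:
  assumes x: "x \<in> hcarrier H" and y: "y \<in> hcarrier H"
  shows "(hnorm H (x - y))\<^sup>2 = (hnorm H x)\<^sup>2 - 2 * Re (hinner H x y) + (hnorm H y)\<^sup>2"
  using x y inner_commute[OF x y] by (simp add: norm_sq mem inner_diff_left inner_diff_right)

lemma norm_triangle:
  assumes x: "x \<in> hcarrier H" and y: "y \<in> hcarrier H"
  shows "hnorm H (x + y) \<le> hnorm H x + hnorm H y"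
proof -
  have "(hnorm H (x + y))\<^sup>2 \<le> (hnorm H x + hnorm H y)\<^sup>2"
    using norm_add_sq[OF x y] Cauchy_Schwarz[OF x y] complex_Re_le_cmod[of "hinner H x y"]
    by (simp add: power2_sum)
  thus ?thesis
    using x y by (simp add: power2_le_iff_abs_le mem)
qed

lemma norm_add_sq_le:
  assumes x: "x \<in> hcarrier H" and y: "y \<in> hcarrier H"
  shows "(hnorm H (x + y))\<^sup>2 \<le> 2 * (hnorm H x)\<^sup>2 + 2 * (hnorm H y)\<^sup>2"
  using norm_add_sq[OF x y] norm_diff_sq[OF x y] zero_le_power2[of "hnorm H (x - y)"] by linarith

lemma complete:
  assumes "\<And>n. s n \<in> hcarrier H"
    and "\<And>e. e > 0 \<Longrightarrow> \<exists>n0. \<forall>m\<ge>n0. \<forall>n\<ge>n0. hnorm H (s m - s n) < e"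
  obtains l where "l \<in> hcarrier H" "(\<lambda>n. hnorm H (s n - l)) \<longlonglongrightarrow> 0"
  using hilbert_space assms unfolding hilbert_space_def by blast

lemma inner_tendsto:
  assumes "((\<lambda>n. hnorm H (s n - l)) \<longlongrightarrow> 0) F" "\<And>n. s n \<in> hcarrier H" "l \<in> hcarrier H"
    and y: "y \<in> hcarrier H"
  shows "((\<lambda>n. hinner H (s n) y) \<longlongrightarrow> hinner H l y) F"
proof (rule LIM_zero_cancel, rule Lim_null_comparison)
  show "\<forall>\<^sub>F n in F. norm (hinner H (s n) y - hinner H l y) \<le> hnorm H (s n - l) * hnorm H y"
    using Cauchy_Schwarz[OF diff_mem y] assms by (simp add: inner_diff_left)
  show "((\<lambda>n. hnorm H (s n - l) * hnorm H y) \<longlongrightarrow> 0) F"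
    using assms(1) by (rule tendsto_mult_left_zero)
qed

lemma norm_limit_unique:
  assumes "F \<noteq> bot" "((\<lambda>n. hnorm H (s n - l)) \<longlongrightarrow> 0) F" "((\<lambda>n. hnorm H (s n - l')) \<longlongrightarrow> 0) F"
    and "\<And>n. s n \<in> hcarrier H" "l \<in> hcarrier H" "l' \<in> hcarrier H"
  shows "l = l'"
proof -
  have "hinner H l (l - l') = hinner H l' (l - l')"
    by (rule tendsto_unique[OF assms(1)]) (use assms in \<open>auto intro!: inner_tendsto diff_mem\<close>)
  hence "hinner H (l - l') (l - l') = 0"
    using assms by (simp add: inner_diff_left diff_mem)
  thus ?thesis
    using inner_pos[of "l - l'"] assms by (force simp: diff_mem)
qed

end

text \<open>A closed subspace is one that is complete in the inherited inner product.\<close>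

definition subhspace :: "('a, 'x) hspace_scheme \<Rightarrow> 'a set \<Rightarrow> 'a hspace"
  where "subhspace H G = \<lparr>hcarrier = G, hinner = hinner H\<rparr>"

lemma subhspace_simps [simp]:
  "hcarrier (subhspace H G) = G" "hinner (subhspace H G) = hinner H"
  "hnorm (subhspace H G) = hnorm H"
  by (simp_all add: subhspace_def hnorm_def fun_eq_iff)

definition closed_subspace :: "('a :: complex_vector, 'x) hspace_scheme \<Rightarrow> 'a set \<Rightarrow> bool"
  where "closed_subspace H G \<longleftrightarrow> G \<subseteq> hcarrier H \<and> hilbert_space (subhspace H G)"

definition orthocomplement :: "('a, 'x) hspace_scheme \<Rightarrow> 'a set \<Rightarrow> 'a set"
  where "orthocomplement H G = {x \<in> hcarrier H. \<forall>y\<in>G. hinner H x y = 0}"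

context hilbert
begin

lemma closed_subspaceI:
  assumes "G \<subseteq> hcarrier H" "complex_vector.subspace G"
    and "\<And>s. \<lbrakk>\<And>n. s n \<in> G; \<And>e. e > 0 \<Longrightarrow> \<exists>n0. \<forall>m\<ge>n0. \<forall>n\<ge>n0. hnorm H (s m - s n) < e\<rbrakk> \<Longrightarrow>
      \<exists>l\<in>G. (\<lambda>n. hnorm H (s n - l)) \<longlonglongrightarrow> 0"
  shows "closed_subspace H G"
proof -
  have "hilbert_space (subhspace H G)"
    unfolding hilbert_space_def subhspace_simps
  proof (intro conjI)
    show "\<forall>x\<in>G. \<forall>y\<in>G. hinner H y x = cnj (hinner H x y)"
      using assms(1) inner_commute by blast
  qed (use assms in \<open>auto simp: inner_add_left inner_scale_left inner_pos subset_iff\<close>)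
  thus ?thesis
    using assms(1) by (simp add: closed_subspace_def)
qed

lemma closed_subspace_zero: "closed_subspace H {0}"
proof (rule closed_subspaceI)
  show "complex_vector.subspace {0 :: 'a}"
    by (rule complex_vector.subspace_single_0)
qed auto

lemma closed_subspace_orthocomplement:
  assumes G: "G \<subseteq> hcarrier H"
  shows "closed_subspace H (orthocomplement H G)"
proof (rule closed_subspaceI)
  show "complex_vector.subspace (orthocomplement H G)"
    using G unfolding complex_vector.subspace_def orthocomplement_def
    by (auto simp: mem inner_add_left inner_scale_left subset_iff)
next
  fix s :: "nat \<Rightarrow> 'a"
  assume s: "\<And>n. s n \<in> orthocomplement H G"
    and Cauchy: "\<And>e. e > 0 \<Longrightarrow> \<exists>n0. \<forall>m\<ge>n0. \<forall>n\<ge>n0. hnorm H (s m - s n) < e"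
  have sH: "\<And>n. s n \<in> hcarrier H"
    using s by (simp add: orthocomplement_def)
  obtain l where l: "l \<in> hcarrier H" "(\<lambda>n. hnorm H (s n - l)) \<longlonglongrightarrow> 0"
    using complete[OF sH Cauchy] by blast
  have "hinner H l y = 0" if "y \<in> G" for y
  proof -
    have "(\<lambda>n. hinner H (s n) y) \<longlonglongrightarrow> hinner H l y"
      using l sH G that by (intro inner_tendsto) auto
    moreover have "hinner H (s n) y = 0" for n
      using s[of n] that by (simp add: orthocomplement_def)
    ultimately show ?thesis
      by (simp add: LIMSEQ_const_iff)
  qed
  thus "\<exists>l\<in>orthocomplement H G. (\<lambda>n. hnorm H (s n - l)) \<longlonglongrightarrow> 0"
    using l by (auto simp: orthocomplement_def)
qed (auto simp: orthocomplement_def)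

text \<open>By the parallelogram law, a sequence in \<open>G\<close> whose distances to \<open>x\<close> approach the distance of
  \<open>x\<close> from \<open>G\<close> is Cauchy; its limit is the nearest point of \<open>G\<close>, and the difference to a nearest
  point has no component along any vector of \<open>G\<close>.\<close>

lemma orthogonal_decomposition:
  assumes G: "closed_subspace H G" and x: "x \<in> hcarrier H"
  obtains g h where "g \<in> G" "h \<in> orthocomplement H G" "x = g + h"
proof -
  interpret G: hilbert "subhspace H G"
    using G by unfold_locales (simp add: closed_subspace_def)
  have GH: "g \<in> hcarrier H" if "g \<in> G" for g
    using G that by (auto simp: closed_subspace_def)
  note Gmem = G.add_mem[simplified] G.scale_mem[simplified] G.zero_mem[simplified]
  define d where "d = (INF g\<in>G. (hnorm H (x - g))\<^sup>2)"
  have bdd: "bdd_below ((\<lambda>g. (hnorm H (x - g))\<^sup>2) ` G)"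
    by (rule bdd_belowI[of _ 0]) auto
  have d_le: "d \<le> (hnorm H (x - g))\<^sup>2" if "g \<in> G" for g
    unfolding d_def using that bdd by (rule cINF_lower[rotated])
  have "\<exists>g\<in>G. (hnorm H (x - g))\<^sup>2 < d + 1 / real (Suc n)" for n
    using cINF_less_iff[OF _ bdd, of "d + 1 / real (Suc n)"] Gmem(3) by (auto simp flip: d_def)
  then obtain s where s: "\<And>n. s n \<in> G" and sd: "\<And>n. (hnorm H (x - s n))\<^sup>2 < d + 1 / real (Suc n)"
    by metis
  have gap: "(hnorm H (s m - s n))\<^sup>2 \<le> 2 / real (Suc m) + 2 / real (Suc n)" for m n
  proof -
    let ?a = "x - s n" and ?b = "x - s m"
    have ab: "?a \<in> hcarrier H" "?b \<in> hcarrier H"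
      using x s GH by (auto intro: mem)
    (* The midpoint lies in G, so its distance from x is at least that of G. *)
    define c where "c = (1/2 :: complex) *\<^sub>C (s n + s m)"
    have c: "c \<in> G"
      unfolding c_def using s by (intro Gmem)
    have "c + c = s n + s m"
      using scaleC_add_left[of "1/2" "1/2" "s n + s m"] by (simp add: c_def scaleC_one)
    hence "?a + ?b = (x - c) + (x - c)"
      by (simp add: algebra_simps)
    also have "\<dots> = 2 *\<^sub>C (x - c)"
      using scaleC_add_left[of 1 1 "x - c"] by (simp add: scaleC_one)
    finally have "(hnorm H (?a + ?b))\<^sup>2 = 4 * (hnorm H (x - c))\<^sup>2"
      using x c GH by (simp add: norm_scale mem power_mult_distrib)
    moreover have "?a - ?b = s m - s n"
      by simp
    ultimately have "(hnorm H (s m - s n))\<^sup>2 =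
        2 * (hnorm H ?a)\<^sup>2 + 2 * (hnorm H ?b)\<^sup>2 - 4 * (hnorm H (x - c))\<^sup>2"
      using norm_add_sq[OF ab] norm_diff_sq[OF ab] by simp
    thus ?thesis
      using sd[of n] sd[of m] d_le[OF c] by simp
  qed
  have Cauchy: "\<exists>n0. \<forall>m\<ge>n0. \<forall>n\<ge>n0. hnorm H (s m - s n) < e" if e: "e > 0" for e
  proof -
    obtain n0 where n0: "1 / real (Suc n0) < e\<^sup>2 / 4"
      using reals_Archimedean[of "e\<^sup>2 / 4"] e by (auto simp: inverse_eq_divide)
    have "hnorm H (s m - s n) < e" if "m \<ge> n0" "n \<ge> n0" for m n
    proof -
      have "1 / real (Suc m) \<le> 1 / real (Suc n0)" "1 / real (Suc n) \<le> 1 / real (Suc n0)"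
        using that by (simp_all add: frac_le)
      hence "(hnorm H (s m - s n))\<^sup>2 < e\<^sup>2"
        using gap[of m n] n0 by simp
      thus ?thesis
        using e by (simp add: power_less_imp_less_base)
    qed
    thus ?thesis by blast
  qed
  obtain l where l: "l \<in> G" "(\<lambda>n. hnorm H (s n - l)) \<longlonglongrightarrow> 0"
    using G.complete[of s] s Cauchy by auto
  have xl: "x - l \<in> hcarrier H"
    using x l GH by (auto intro: mem)
  have near: "(hnorm H (x - l))\<^sup>2 \<le> d"
  proof -
    have "hnorm H (x - l) \<le> sqrt (d + 1 / real (Suc n)) + hnorm H (s n - l)" for n
    proof -
      have "hnorm H (x - l) \<le> hnorm H (x - s n) + hnorm H (s n - l)"
        using norm_triangle[of "x - s n" "s n - l"] x l s GH by (simp add: mem)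
      moreover have "hnorm H (x - s n) \<le> sqrt (d + 1 / real (Suc n))"
        using sd[of n] by (intro real_le_rsqrt) auto
      ultimately show ?thesis by simp
    qed
    moreover have "(\<lambda>n. sqrt (d + 1 / real (Suc n)) + hnorm H (s n - l)) \<longlonglongrightarrow> sqrt (d + 0) + 0"
      using l(2) by (intro tendsto_intros LIMSEQ_Suc[OF lim_1_over_n])
    ultimately have "hnorm H (x - l) \<le> sqrt (d + 0) + 0"
      by (intro LIMSEQ_le_const) auto
    moreover have "0 \<le> d"
      unfolding d_def using Gmem(3) by (intro cINF_greatest) auto
    ultimately show ?thesis
      using power_mono[of "hnorm H (x - l)" "sqrt d" 2] xl by simp
  qed
  have "hinner H (x - l) y = 0" if y: "y \<in> G" for y
  proof (cases "y = 0")
    case False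
    define c where "c = hinner H (x - l) y / of_real ((hnorm H y)\<^sup>2)"
    have "d \<le> (hnorm H (x - (l + c *\<^sub>C y)))\<^sup>2"
      using l y by (intro d_le Gmem)
    also have "\<dots> = (hnorm H (x - l))\<^sup>2 - (cmod (hinner H (x - l) y))\<^sup>2 / (hnorm H y)\<^sup>2"
      using norm_sub_component[OF xl GH[OF y] False] by (simp add: c_def algebra_simps)
    finally have "(cmod (hinner H (x - l) y))\<^sup>2 / (hnorm H y)\<^sup>2 \<le> 0"
      using near by simp
    moreover have "hnorm H y \<noteq> 0"
      using False GH[OF y] by (simp add: norm_eq_zero)
    ultimately show ?thesis
      by (simp add: divide_le_0_iff)
  qed (use xl in simp)
  hence "x - l \<in> orthocomplement H G"
    using xl by (simp add: orthocomplement_def)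
  thus thesis
    using that[OF l(1), of "x - l"] by simp
qed

lemma orthocomplement_disjoint:
  assumes "x \<in> G" "x \<in> orthocomplement H G"
  shows "x = 0"
  using assms inner_pos[of x] by (auto simp: orthocomplement_def)

end

text \<open>A norm preserving linear map transports Cauchy sequences and limits in both directions, so
  its range is again complete and its inverse is bounded.\<close>

lemma isometric_image:
  fixes H :: "('a :: complex_vector, 'x) hspace_scheme"
    and K :: "('b :: complex_vector, 'y) hspace_scheme"
  assumes "hilbert_space H" "hilbert_space K" "bounded_op H K J"
    and norm: "\<And>x. x \<in> hcarrier H \<Longrightarrow> hnorm K (J x) = hnorm H x"
  shows "closed_subspace K (J ` hcarrier H)"
    and "inj_on J (hcarrier H)"
    and "bounded_op (subhspace K (J ` hcarrier H)) H (inv_into (hcarrier H) J)"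
proof -
  interpret H: hilbert H by unfold_locales fact
  interpret K: hilbert K by unfold_locales fact
  have J: "\<And>x. x \<in> hcarrier H \<Longrightarrow> J x \<in> hcarrier K"
    "\<And>x y. x \<in> hcarrier H \<Longrightarrow> y \<in> hcarrier H \<Longrightarrow> J (x + y) = J x + J y"
    "\<And>c x. x \<in> hcarrier H \<Longrightarrow> J (c *\<^sub>C x) = c *\<^sub>C J x"
    using assms(3) by (auto simp: bounded_op_def)
  have J0: "J 0 = 0"
    using J(3)[of 0 0] by simp
  have Jd: "J (x - y) = J x - J y" if "x \<in> hcarrier H" "y \<in> hcarrier H" for x y
    using J(2)[of "x - y" y] that by (simp add: H.mem)
  show inj: "inj_on J (hcarrier H)"
  proof (rule inj_onI)
    fix x y assume xy: "x \<in> hcarrier H" "y \<in> hcarrier H" "J x = J y"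
    hence "hnorm H (x - y) = 0"
      using norm[of "x - y"] Jd[of x y] by (simp add: H.mem)
    thus "x = y"
      using xy by (simp add: H.norm_eq_zero H.mem)
  qed
  show "closed_subspace K (J ` hcarrier H)"
  proof (rule K.closed_subspaceI)
    show "complex_vector.subspace (J ` hcarrier H)"
      unfolding complex_vector.subspace_def
    proof (intro conjI ballI allI)
      show "0 \<in> J ` hcarrier H"
        using J0 H.zero_mem by (metis image_eqI)
    qed (auto simp: H.mem simp flip: J(2,3))
  next
    fix s :: "nat \<Rightarrow> 'b"
    assume s: "\<And>n. s n \<in> J ` hcarrier H"
      and Cauchy: "\<And>e. e > 0 \<Longrightarrow> \<exists>n0. \<forall>m\<ge>n0. \<forall>n\<ge>n0. hnorm K (s m - s n) < e"
    have "\<exists>t. t \<in> hcarrier H \<and> s n = J t" for n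
      using s[of n] by auto
    then obtain t where t: "\<And>n. t n \<in> hcarrier H" "\<And>n. s n = J (t n)"
      by metis
    have "hnorm K (s m - s n) = hnorm H (t m - t n)" for m n
      using norm[of "t m - t n"] t Jd by (simp add: H.mem)
    hence "\<exists>n0. \<forall>m\<ge>n0. \<forall>n\<ge>n0. hnorm H (t m - t n) < e" if "e > 0" for e
      using Cauchy[OF that] by simp
    then obtain l where l: "l \<in> hcarrier H" "(\<lambda>n. hnorm H (t n - l)) \<longlonglongrightarrow> 0"
      using H.complete[of t] t by blast
    have "hnorm K (s n - J l) = hnorm H (t n - l)" for n
      using norm[of "t n - l"] t l Jd by (simp add: H.mem)
    thus "\<exists>l\<in>J ` hcarrier H. (\<lambda>n. hnorm K (s n - l)) \<longlonglongrightarrow> 0"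
      using l by (auto intro!: bexI[of _ l])
  qed (use J in auto)
  show "bounded_op (subhspace K (J ` hcarrier H)) H (inv_into (hcarrier H) J)"
    unfolding bounded_op_def subhspace_simps ball_simps
  proof (intro conjI ballI allI exI[of _ 1])
    fix c x y assume x: "x \<in> hcarrier H" and y: "y \<in> hcarrier H"
    show "inv_into (hcarrier H) J (J x + J y) =
        inv_into (hcarrier H) J (J x) + inv_into (hcarrier H) J (J y)"
      using x y inj by (simp add: inv_into_f_f H.mem flip: J(2,3))
    show "inv_into (hcarrier H) J (c *\<^sub>C J x) = c *\<^sub>C inv_into (hcarrier H) J (J x)"
      using x inj by (simp add: inv_into_f_f H.mem flip: J(2,3))
  qed (use inj norm in \<open>auto simp: inv_into_f_f\<close>)
qed


section \<open>Power series in several variables\<close>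

lemma has_sum_zero_imp_coeff_zero:
  fixes a :: "nat \<Rightarrow> complex"
  assumes "r > 0" and sums: "\<And>x. cmod x < r \<Longrightarrow> ((\<lambda>n. a n * x ^ n) has_sum 0) UNIV"
  shows "a n = 0"
proof -
  have "(\<lambda>n. a n * of_real (r / 2) ^ n) sums 0"
    using assms by (intro has_sum_imp_sums sums) auto
  hence "conv_radius a \<ge> norm (of_real (r / 2) :: complex)"
    by (intro conv_radius_geI) (auto simp: sums_iff)
  hence "fps_conv_radius (Abs_fps a) > 0"
    using assms(1) by (simp add: fps_conv_radius_def) (metis ereal_less(2) half_gt_zero less_le_trans)
  moreover have "eventually (\<lambda>x. eval_fps (Abs_fps a) x = eval_fps 0 x) (nhds 0)"
    unfolding eventually_nhds_metric
    using assms has_sum_imp_sums[OF sums] by (auto intro!: exI[of _ r] simp: eval_fps_def sums_iff)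
  ultimately have "Abs_fps a = 0"
    by (intro eval_fps_eqD) auto
  thus ?thesis
    by (metis fps_nth_Abs_fps fps_zero_nth)
qed

text \<open>Sorting the terms by the exponent of one variable gives a power series in that variable
  alone, whose coefficients therefore vanish. This removes the variables one after the other.\<close>

lemma multivariate_coeff_zero:
  fixes c :: "('m :: finite \<Rightarrow> nat) \<Rightarrow> complex"
  assumes "r > 0"
    and sums: "\<And>z. (\<And>i. cmod (z i) < r) \<Longrightarrow> ((\<lambda>k. c k * (\<Prod>i\<in>UNIV. z i ^ k i)) has_sum 0) UNIV"
  shows "c l = 0"
proof -
  have "((\<lambda>k. c k * (\<Prod>i\<in>-S. z i ^ k i)) has_sum 0) {k. \<forall>i\<in>S. k i = l i}"
    if "finite S" "\<And>i. cmod (z i) < r" for S z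
    using that
  proof (induction S arbitrary: z rule: finite_induct)
    case (insert i S)
    define B where "B = {k :: 'm \<Rightarrow> nat. \<forall>j\<in>S. k j = l j}"
    define B' where "B' n = {k \<in> B. k i = n}" for n
    define p where "p k = c k * (\<Prod>j\<in>-insert i S. z j ^ k j)" for k
    define g where "g n = infsum p (B' n)" for n
    have split: "-S = insert i (-insert i S)"
      using insert.hyps by auto
    have px: "((\<lambda>k. p k * x ^ k i) has_sum 0) B" if "cmod x < r" for x
    proof -
      have "((\<lambda>k. c k * (\<Prod>j\<in>-S. (z(i := x)) j ^ k j)) has_sum 0) B"
        unfolding B_def using insert.prems that by (intro insert.IH) auto
      moreover have "(\<Prod>j\<in>-S. (z(i := x)) j ^ k j) = x ^ k i * (\<Prod>j\<in>-insert i S. z j ^ k j)" for k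
        by (subst split, subst prod.insert) (auto intro!: arg_cong2[of _ _ _ _ "(*)"] prod.cong)
      ultimately show ?thesis
        by (simp add: p_def mult_ac)
    qed
    have summable: "p summable_on B' n" for n
    proof -
      (* On B' n the power of x is a common factor, which cancels at any x other than 0. *)
      have "(\<lambda>k. p k * of_real (r / 2) ^ k i) summable_on B' n"
        using px[of "of_real (r / 2)"] assms(1)
        by (intro summable_on_subset_banach[of _ B "B' n"]) (auto simp: summable_on_def B'_def)
      hence "(\<lambda>k. p k * of_real (r / 2) ^ n) summable_on B' n"
        by (rule summable_on_cong[THEN iffD1, rotated]) (auto simp: B'_def)
      thus ?thesis
        using assms(1) by (subst (asm) summable_on_cmult_left') auto
    qed
    have "((\<lambda>n. g n * x ^ n) has_sum 0) UNIV" if x: "cmod x < r" for x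
    proof (rule has_sum_SigmaD)
      show "((\<lambda>(n, k). p k * x ^ n) has_sum 0) (Sigma UNIV B')"
        by (rule has_sum_reindex_bij_witness[of B snd "\<lambda>k. (k i, k)", THEN iffD1, OF _ _ _ _ _ _ px[OF x]])
          (auto simp: B'_def)
      show "((\<lambda>k. case (n, k) of (n, k) \<Rightarrow> p k * x ^ n) has_sum g n * x ^ n) (B' n)" for n
        using has_sum_infsum[OF summable] by (auto simp: g_def intro: has_sum_cmult_left)
    qed
    hence "g (l i) = 0"
      by (rule has_sum_zero_imp_coeff_zero[OF assms(1)])
    hence "(p has_sum 0) (B' (l i))"
      using has_sum_infsum[OF summable, of "l i"] by (simp add: g_def)
    moreover have "B' (l i) = {k. \<forall>j\<in>insert i S. k j = l j}"
      by (auto simp: B'_def B_def)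
    ultimately show ?case
      by (simp add: p_def[abs_def])
  qed (use sums in simp)
  from this[of UNIV "\<lambda>_. 0"] have "(c has_sum 0) {l}"
    using assms(1) by (simp flip: fun_eq_iff)
  thus ?thesis
    using has_sum_finite[of "{l}" c] has_sum_unique by fastforce
qed

context hilbert
begin

lemma has_power_series_inner:
  assumes f: "has_power_series H f a" and z: "z \<in> ball 0 1" and y: "y \<in> hcarrier H"
  shows "((\<lambda>k. monomial z k * hinner H (a k) y) has_sum hinner H (f z) y) UNIV"
proof -
  have a: "a k \<in> hcarrier H" for k
    using f by (simp add: has_power_series_def)
  have "((\<lambda>K. hinner H (\<Sum>k\<in>K. monomial z k *\<^sub>C a k) y) \<longlongrightarrow> hinner H (f z) y)
      (finite_subsets_at_top UNIV)"
    using f z y a by (intro inner_tendsto) (auto simp: has_power_series_def mem)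
  thus ?thesis
    using a y by (simp add: has_sum_def inner_sum_left scale_mem inner_scale_left)
qed

text \<open>Pairing with a vector turns a vector valued power series into a scalar one, and the vectors
  separate the coefficients.\<close>

lemma power_series_unique:
  fixes f :: "complex ^ 'm :: finite \<Rightarrow> 'a"
  assumes f: "has_power_series H f a" "has_power_series H f b"
  shows "a = b"
proof
  fix l
  have ab: "a k \<in> hcarrier H" "b k \<in> hcarrier H" for k
    using f by (simp_all add: has_power_series_def)
  define y where "y = a l - b l"
  have y: "y \<in> hcarrier H"
    using ab by (simp add: y_def mem)
  have "hinner H (a l - b l) y = 0"
  proof (rule multivariate_coeff_zero)
    show "1 / real CARD('m) > 0"
      by simp
    fix z :: "'m \<Rightarrow> complex"
    assume z: "\<And>i. cmod (z i) < 1 / real CARD('m)"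
    have "norm (\<chi> i. z i) \<le> (\<Sum>i\<in>UNIV. cmod (z i))"
      unfolding norm_vec_def by (simp add: L2_set_le_sum)
    also have "\<dots> < (\<Sum>i\<in>(UNIV :: 'm set). 1 / real CARD('m))"
      using z by (intro sum_strict_mono) auto
    finally have "(\<chi> i. z i) \<in> ball 0 1"
      by simp
    from has_sum_add[OF has_power_series_inner[OF f(1) this y]
        has_sum_uminusI[OF has_power_series_inner[OF f(2) this y]]]
    show "((\<lambda>k. hinner H (a k - b k) y * (\<Prod>i\<in>UNIV. z i ^ k i)) has_sum 0) UNIV"
      using ab y by (simp add: inner_diff_left monomial_def algebra_simps)
  qed
  thus "a l = b l"
    using inner_pos[of y] y by (force simp: y_def)
qed

lemma taylor_coeff_eq:
  assumes "has_power_series H f a"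
  shows "taylor_coeff H f = a"
proof (rule power_series_unique)
  show "has_power_series H f (taylor_coeff H f)"
    unfolding taylor_coeff_def using assms by (rule someI[of "has_power_series H f"])
qed fact

end


section \<open>The Drury-Arveson module\<close>

lemma DA_carrierI:
  assumes "\<And>z. z \<notin> ball 0 1 \<Longrightarrow> f z = 0" "has_power_series E f a"
    "(\<lambda>k. DA_weight k * (hnorm E (a k))\<^sup>2) summable_on UNIV"
  shows "f \<in> hcarrier (DA_module E)"
  using assms by (auto simp: DA_module_def)

lemma DA_carrierE:
  assumes "f \<in> hcarrier (DA_module E)"
  obtains a where "has_power_series E f a"
    "(\<lambda>k. DA_weight k * (hnorm E (a k))\<^sup>2) summable_on UNIV"
  using assms by (auto simp: DA_module_def)

lemma DA_outside: "\<lbrakk>f \<in> hcarrier (DA_module E); z \<notin> ball 0 1\<rbrakk> \<Longrightarrow> f z = 0"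
  by (simp add: DA_module_def)

lemma DA_value: "\<lbrakk>f \<in> hcarrier (DA_module E); z \<in> ball 0 1\<rbrakk> \<Longrightarrow> f z \<in> hcarrier E"
  by (auto simp: DA_module_def has_power_series_def)

lemma DA_act [simp]: "act (DA_module E) i f z = (z $ i) *\<^sub>C f z"
  by (simp add: DA_module_def)

lemma DA_weight_pos [simp]: "DA_weight k > 0"
  by (simp add: DA_weight_def prod_pos)

lemma DA_weight_nonneg [simp]: "DA_weight k \<ge> 0"
  using DA_weight_pos[of k] by linarith

lemma bounded_op_0:
  assumes "hilbert_space H" "bounded_op H K T"
  shows "T 0 = 0"
  using assms hilbert.zero_mem[of H]
  unfolding bounded_op_def by (metis complex_vector.scale_zero_left hilbert.intro)

lemma bounded_op_sum:
  assumes H: "hilbert_space H" and T: "bounded_op H K T" and "\<And>i. i \<in> A \<Longrightarrow> f i \<in> hcarrier H"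
  shows "T (\<Sum>i\<in>A. c i *\<^sub>C f i) = (\<Sum>i\<in>A. c i *\<^sub>C T (f i))"
proof -
  interpret hilbert H by unfold_locales fact
  show ?thesis
    using assms(3)
    by (induction A rule: infinite_finite_induct)
      (use T bounded_op_0[OF H T] in \<open>simp_all add: bounded_op_def mem\<close>)
qed

lemma bounded_op_diff:
  assumes "hilbert_space H" "bounded_op H K T" "x \<in> hcarrier H" "y \<in> hcarrier H"
  shows "T (x - y) = T x - T y"
proof -
  interpret hilbert H by unfold_locales fact
  have "T (x - y + y) = T (x - y) + T y"
    using assms diff_mem[of x y] unfolding bounded_op_def by blast
  thus ?thesis by simp
qed

lemma bounded_op_bound:
  assumes "hilbert_space H" "bounded_op H K T"
  obtains B where "B \<ge> 0" "\<And>x. x \<in> hcarrier H \<Longrightarrow> hnorm K (T x) \<le> B * hnorm H x"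
proof -
  interpret hilbert H by unfold_locales fact
  obtain B where B: "\<And>x. x \<in> hcarrier H \<Longrightarrow> hnorm K (T x) \<le> B * hnorm H x"
    using assms(2) unfolding bounded_op_def by blast
  have "hnorm K (T x) \<le> \<bar>B\<bar> * hnorm H x" if "x \<in> hcarrier H" for x
    using B[OF that] mult_right_mono[OF abs_ge_self norm_nonneg[OF that], of B] by linarith
  thus thesis
    using that[of "\<bar>B\<bar>"] by simp
qed

text \<open>A bounded operator between coefficient spaces acts on the whole module by acting on values,
  equivalently on Taylor coefficients; it is the multiplication by a constant multiplier.\<close>

lemma
  fixes f :: "complex ^ 'm :: finite \<Rightarrow> 'a :: complex_vector"
    and E :: "('a, 'x) hspace_scheme" and F :: "('b :: complex_vector, 'y) hspace_scheme"
  assumes E: "hilbert_space E" and F: "hilbert_space F" and T: "bounded_op E F T"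
  shows power_series_const_mult:
      "has_power_series E f a \<Longrightarrow> has_power_series F (mult_op (\<lambda>_. T) f) (\<lambda>k. T (a k))"
    and DA_const_mult:
      "f \<in> hcarrier (DA_module E) \<Longrightarrow> mult_op (\<lambda>_. T) f \<in> hcarrier (DA_module F)"
proof -
  interpret E: hilbert E by unfold_locales fact
  interpret F: hilbert F by unfold_locales fact
  obtain B where "B \<ge> 0" and B: "\<And>x. x \<in> hcarrier E \<Longrightarrow> hnorm F (T x) \<le> B * hnorm E x"
    using bounded_op_bound[OF E T] by blast
  have TF: "T x \<in> hcarrier F" if "x \<in> hcarrier E" for x
    using T that by (simp add: bounded_op_def)
  show ps: "has_power_series F (mult_op (\<lambda>_. T) f) (\<lambda>k. T (a k))" if f: "has_power_series E f a" for a
    unfolding has_power_series_def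
  proof (intro conjI allI ballI)
    have a: "a k \<in> hcarrier E" for k
      using f by (simp add: has_power_series_def)
    show "T (a k) \<in> hcarrier F" for k
      using a by (rule TF)
    fix z :: "complex ^ 'm" assume z: "z \<in> ball 0 1"
    have fz: "f z \<in> hcarrier E"
      using f z by (simp add: has_power_series_def)
    thus "mult_op (\<lambda>_. T) f z \<in> hcarrier F"
      using z TF by (simp add: mult_op_def)
    let ?s = "\<lambda>K. (\<Sum>k\<in>K. monomial z k *\<^sub>C a k)"
    have eq: "(\<Sum>k\<in>K. monomial z k *\<^sub>C T (a k)) - mult_op (\<lambda>_. T) f z = T (?s K - f z)" for K
    proof -
      have "(\<Sum>k\<in>K. monomial z k *\<^sub>C T (a k)) = T (?s K)"
        by (rule bounded_op_sum[OF E T, symmetric]) (rule a)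
      thus ?thesis
        using z fz a bounded_op_diff[OF E T] by (simp add: mult_op_def E.mem)
    qed
    show "((\<lambda>K. hnorm F ((\<Sum>k\<in>K. monomial z k *\<^sub>C T (a k)) - mult_op (\<lambda>_. T) f z)) \<longlongrightarrow> 0)
        (finite_subsets_at_top UNIV)"
      unfolding eq
    proof (rule Lim_null_comparison)
      show "\<forall>\<^sub>F K in finite_subsets_at_top UNIV. norm (hnorm F (T (?s K - f z))) \<le> B * hnorm E (?s K - f z)"
        using fz a B TF by (simp add: E.mem)
      have "((\<lambda>K. hnorm E (?s K - f z)) \<longlongrightarrow> 0) (finite_subsets_at_top UNIV)"
        using f z by (simp add: has_power_series_def)
      thus "((\<lambda>K. B * hnorm E (?s K - f z)) \<longlongrightarrow> 0) (finite_subsets_at_top UNIV)"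
        by (rule tendsto_mult_right_zero)
    qed
  qed
  show "mult_op (\<lambda>_. T) f \<in> hcarrier (DA_module F)" if f: "f \<in> hcarrier (DA_module E)"
  proof -
    obtain a where a: "has_power_series E f a"
      "(\<lambda>k. DA_weight k * (hnorm E (a k))\<^sup>2) summable_on UNIV"
      using f by (rule DA_carrierE)
    have "(\<lambda>k. DA_weight k * (hnorm F (T (a k)))\<^sup>2) summable_on UNIV"
    proof (rule summable_on_comparison_test)
      show "(\<lambda>k. B\<^sup>2 * (DA_weight k * (hnorm E (a k))\<^sup>2)) summable_on UNIV"
        using a(2) by (rule summable_on_cmult_right)
      fix k
      have ak: "a k \<in> hcarrier E"
        using a(1) by (simp add: has_power_series_def)
      have "(hnorm F (T (a k)))\<^sup>2 \<le> (B * hnorm E (a k))\<^sup>2"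
        using B[OF ak] TF[OF ak] by (intro power_mono) auto
      hence "DA_weight k * (hnorm F (T (a k)))\<^sup>2 \<le> DA_weight k * (B * hnorm E (a k))\<^sup>2"
        by (rule mult_left_mono) simp
      thus "DA_weight k * (hnorm F (T (a k)))\<^sup>2 \<le> B\<^sup>2 * (DA_weight k * (hnorm E (a k))\<^sup>2)"
        by (simp add: power_mult_distrib mult_ac)
    qed simp
    with ps[OF a(1)] show ?thesis
      by (intro DA_carrierI) (auto simp: mult_op_def)
  qed
qed

text \<open>With exponent zero, these are the constant functions of the module.\<close>

definition DA_monomial :: "('m \<Rightarrow> nat) \<Rightarrow> 'e \<Rightarrow> complex ^ 'm :: finite \<Rightarrow> 'e :: complex_vector"
  where "DA_monomial k x = (\<lambda>z. if z \<in> ball 0 1 then monomial z k *\<^sub>C x else 0)"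

context hilbert
begin

lemma DA_taylor:
  assumes "f \<in> hcarrier (DA_module H)"
  shows "has_power_series H f (taylor_coeff H f)"
    and "(\<lambda>k. DA_weight k * (hnorm H (taylor_coeff H f k))\<^sup>2) summable_on UNIV"
    and "taylor_coeff H f k \<in> hcarrier H"
proof -
  obtain a where a: "has_power_series H f a"
    "(\<lambda>k. DA_weight k * (hnorm H (a k))\<^sup>2) summable_on UNIV"
    using assms by (rule DA_carrierE)
  moreover have "taylor_coeff H f = a"
    using a(1) by (rule taylor_coeff_eq)
  ultimately show "has_power_series H f (taylor_coeff H f)"
    and "(\<lambda>k. DA_weight k * (hnorm H (taylor_coeff H f k))\<^sup>2) summable_on UNIV"
    and "taylor_coeff H f k \<in> hcarrier H"
    by (simp_all add: has_power_series_def)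
qed

lemma DA_norm_summable:
  assumes "f \<in> hcarrier (DA_module H)" "has_power_series H f a"
  shows "(\<lambda>k. DA_weight k * (hnorm H (a k))\<^sup>2) summable_on UNIV"
  using DA_taylor(2)[OF assms(1)] taylor_coeff_eq[OF assms(2)] by simp

lemma DA_inner:
  assumes "has_power_series H f a" "has_power_series H g b"
  shows "hinner (DA_module H) f g = (\<Sum>\<^sub>\<infinity>k. of_real (DA_weight k) * hinner H (a k) (b k))"
  using assms by (simp add: DA_module_def taylor_coeff_eq)

lemma DA_norm:
  fixes f :: "complex ^ 'm :: finite \<Rightarrow> 'a"
  assumes f: "f \<in> hcarrier (DA_module H)" and a: "has_power_series H f a"
  shows "hnorm (DA_module H) f = sqrt (\<Sum>\<^sub>\<infinity>k. DA_weight k * (hnorm H (a k))\<^sup>2)"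
proof -
  have aH: "a k \<in> hcarrier H" for k
    using a by (simp add: has_power_series_def)
  have "hinner (DA_module H) f f = (\<Sum>\<^sub>\<infinity>k. of_real (DA_weight k * (hnorm H (a k))\<^sup>2))"
    using aH by (simp add: DA_inner[OF a a] inner_self)
  also have "\<dots> = of_real (\<Sum>\<^sub>\<infinity>k. DA_weight k * (hnorm H (a k))\<^sup>2)"
    using DA_norm_summable[OF f a] by (intro infsumI has_sum_of_real has_sum_infsum)
  finally show ?thesis
    by (simp add: hnorm_def[of "DA_module H"])
qed

lemma DA_monomial_power_series:
  fixes k :: "'m :: finite \<Rightarrow> nat"
  assumes x: "x \<in> hcarrier H"
  shows "has_power_series H (DA_monomial k x) (\<lambda>j. if j = k then x else 0)"
  unfolding has_power_series_def
proof (intro conjI allI ballI)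
  fix z :: "complex ^ 'm" assume z: "z \<in> ball 0 1"
  show "DA_monomial k x z \<in> hcarrier H"
    using x by (simp add: DA_monomial_def scale_mem)
  have "hnorm H ((\<Sum>j\<in>K. monomial z j *\<^sub>C (if j = k then x else 0)) - DA_monomial k x z) = 0"
    if K: "finite K" "{k} \<subseteq> K" for K
  proof -
    have "(\<Sum>j\<in>K. monomial z j *\<^sub>C (if j = k then x else 0)) =
        (\<Sum>j\<in>K. if j = k then monomial z k *\<^sub>C x else 0)"
      by (intro sum.cong) auto
    also have "\<dots> = monomial z k *\<^sub>C x"
      using K by simp
    finally show ?thesis
      using z by (simp add: DA_monomial_def)
  qed
  thus "((\<lambda>K. hnorm H ((\<Sum>j\<in>K. monomial z j *\<^sub>C (if j = k then x else 0)) - DA_monomial k x z))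
      \<longlongrightarrow> 0) (finite_subsets_at_top UNIV)"
    by (intro tendsto_eventually) (auto simp: eventually_finite_subsets_at_top intro!: exI[of _ "{k}"])
qed (use x in simp)

lemma DA_monomial_mem:
  assumes x: "x \<in> hcarrier H"
  shows "DA_monomial k x \<in> hcarrier (DA_module H)"
proof (rule DA_carrierI[OF _ DA_monomial_power_series[OF x]])
  show "(\<lambda>j. DA_weight j * (hnorm H (if j = k then x else 0))\<^sup>2) summable_on UNIV"
    by (rule finite_nonzero_values_imp_summable_on) (rule finite_subset[of _ "{k}"], auto)
qed (auto simp: DA_monomial_def)

text \<open>Pairing with monomials reads off single Taylor coefficients.\<close>

lemma DA_inner_monomial:
  assumes x: "x \<in> hcarrier H" and f: "has_power_series H f a"
  shows "hinner (DA_module H) (DA_monomial k x) f = of_real (DA_weight k) * hinner H x (a k)"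
proof -
  have a: "a k \<in> hcarrier H" for k
    using f by (simp add: has_power_series_def)
  have "((\<lambda>j. of_real (DA_weight j) * hinner H (if j = k then x else 0) (a j)) has_sum
      of_real (DA_weight k) * hinner H x (a k)) UNIV"
    by (rule has_sum_finite_neutralI[of "{k}"]) (use a in auto)
  thus ?thesis
    unfolding DA_inner[OF DA_monomial_power_series[OF x] f] by (rule infsumI)
qed

lemma DA_norm_monomial:
  assumes x: "x \<in> hcarrier H"
  shows "hnorm (DA_module H) (DA_monomial k x) = sqrt (DA_weight k) * hnorm H x"
  using DA_inner_monomial[OF x DA_monomial_power_series[OF x], of k k] x
  by (simp add: hnorm_def[of "DA_module H"] inner_self real_sqrt_mult)

lemma DA_add:
  fixes f g :: "complex ^ 'm :: finite \<Rightarrow> 'a"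
  assumes f: "f \<in> hcarrier (DA_module H)" and g: "g \<in> hcarrier (DA_module H)"
  shows "f + g \<in> hcarrier (DA_module H)"
proof -
  obtain a where a: "has_power_series H f a"
      "(\<lambda>k. DA_weight k * (hnorm H (a k))\<^sup>2) summable_on UNIV"
    using f by (rule DA_carrierE)
  obtain b where b: "has_power_series H g b"
      "(\<lambda>k. DA_weight k * (hnorm H (b k))\<^sup>2) summable_on UNIV"
    using g by (rule DA_carrierE)
  have abH: "a k \<in> hcarrier H" "b k \<in> hcarrier H" for k
    using a b by (simp_all add: has_power_series_def)
  have series: "has_power_series H (f + g) (\<lambda>k. a k + b k)"
    unfolding has_power_series_def
  proof (intro conjI allI ballI)
    show "a k + b k \<in> hcarrier H" for k
      using abH by (intro mem)
    fix z :: "complex ^ 'm" assume z: "z \<in> ball 0 1"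
    have fg: "f z \<in> hcarrier H" "g z \<in> hcarrier H"
      using a b z by (simp_all add: has_power_series_def)
    thus "(f + g) z \<in> hcarrier H"
      by (simp add: mem)
    let ?s = "\<lambda>K. (\<Sum>k\<in>K. monomial z k *\<^sub>C a k) - f z"
    let ?t = "\<lambda>K. (\<Sum>k\<in>K. monomial z k *\<^sub>C b k) - g z"
    have st: "?s K \<in> hcarrier H" "?t K \<in> hcarrier H" for K
      using abH fg by (auto intro!: mem)
    have eq: "(\<Sum>k\<in>K. monomial z k *\<^sub>C (a k + b k)) - (f + g) z = ?s K + ?t K" for K
      by (simp add: scaleC_add_right sum.distrib)
    show "((\<lambda>K. hnorm H ((\<Sum>k\<in>K. monomial z k *\<^sub>C (a k + b k)) - (f + g) z)) \<longlongrightarrow> 0)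
        (finite_subsets_at_top UNIV)"
      unfolding eq
    proof (rule Lim_null_comparison)
      show "\<forall>\<^sub>F K in finite_subsets_at_top UNIV. norm (hnorm H (?s K + ?t K)) \<le> hnorm H (?s K) + hnorm H (?t K)"
        using norm_triangle[OF st] norm_nonneg[OF add_mem[OF st]] by (intro always_eventually) simp
      have "((\<lambda>K. hnorm H (?s K)) \<longlongrightarrow> 0) (finite_subsets_at_top UNIV)"
        "((\<lambda>K. hnorm H (?t K)) \<longlongrightarrow> 0) (finite_subsets_at_top UNIV)"
        using a b z by (simp_all add: has_power_series_def)
      thus "((\<lambda>K. hnorm H (?s K) + hnorm H (?t K)) \<longlongrightarrow> 0) (finite_subsets_at_top UNIV)"
        by (rule tendsto_add_zero)
    qed
  qed
  have "(\<lambda>k. DA_weight k * (hnorm H (a k + b k))\<^sup>2) summable_on UNIV"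
  proof (rule summable_on_comparison_test)
    show "(\<lambda>k. 2 * (DA_weight k * (hnorm H (a k))\<^sup>2) + 2 * (DA_weight k * (hnorm H (b k))\<^sup>2)) summable_on UNIV"
      using a(2) b(2) by (intro summable_on_add summable_on_cmult_right)
    show "DA_weight k * (hnorm H (a k + b k))\<^sup>2 \<le>
        2 * (DA_weight k * (hnorm H (a k))\<^sup>2) + 2 * (DA_weight k * (hnorm H (b k))\<^sup>2)" for k
      using mult_left_mono[OF norm_add_sq_le[OF abH], of "DA_weight k" k k] by (simp add: algebra_simps)
  qed simp
  with series show ?thesis
    using f g by (intro DA_carrierI) (simp add: DA_outside)
qed

lemma bounded_op_scale: "bounded_op H H ((*\<^sub>C) c)"
  unfolding bounded_op_def
  by (auto simp: mem norm_scale scaleC_add_right scaleC_scaleC mult.commute intro!: exI[of _ "cmod c"])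

lemma DA_scale:
  assumes f: "f \<in> hcarrier (DA_module H)"
  shows "c *\<^sub>C f \<in> hcarrier (DA_module H)"
proof -
  have "c *\<^sub>C f = mult_op (\<lambda>_. (*\<^sub>C) c) f"
    using DA_outside[OF f] by (auto simp: fun_eq_iff mult_op_def scaleC_fun_def)
  thus ?thesis
    using DA_const_mult[OF hilbert_space hilbert_space bounded_op_scale f] by simp
qed

lemma DA_diff:
  assumes f: "f \<in> hcarrier (DA_module H)" and g: "g \<in> hcarrier (DA_module H)"
  shows "f - g \<in> hcarrier (DA_module H)"
proof -
  have "f - g = f + (-1) *\<^sub>C g"
    by (simp add: fun_eq_iff scaleC_fun_def)
  thus ?thesis
    using f g by (metis DA_add DA_scale)
qed

end


section \<open>Multiplication by a coordinate function\<close>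

abbreviation raise :: "'m \<Rightarrow> ('m \<Rightarrow> nat) \<Rightarrow> 'm \<Rightarrow> nat"
  where "raise i k \<equiv> k(i := Suc (k i))"

text \<open>The Taylor coefficients of \<open>z\<^sub>i f\<close> in terms of those of \<open>f\<close>.\<close>

definition shift_coeff :: "'m \<Rightarrow> (('m \<Rightarrow> nat) \<Rightarrow> 'e :: zero) \<Rightarrow> ('m \<Rightarrow> nat) \<Rightarrow> 'e"
  where "shift_coeff i a k = (if k i = 0 then 0 else a (k(i := k i - 1)))"

lemma inj_raise: "inj (raise i)"
proof (rule injI)
  fix k l :: "'a \<Rightarrow> nat" assume "raise i k = raise i l"
  hence "raise i k j = raise i l j" for j
    by simp
  thus "k = l"
    by (metis fun_upd_other fun_upd_same nat.inject ext)
qed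

lemma shift_coeff_raise [simp]: "shift_coeff i a (raise i k) = a k"
  by (simp add: shift_coeff_def)

lemma shift_coeff_outside:
  assumes "k \<notin> range (raise i)"
  shows "shift_coeff i a k = 0"
proof (rule ccontr)
  assume "shift_coeff i a k \<noteq> 0"
  hence "k = raise i (k(i := k i - 1))"
    by (auto simp: shift_coeff_def fun_eq_iff split: if_splits)
  thus False
    using assms by blast
qed

lemma monomial_raise: "monomial z (raise i k) = z $ i * monomial z k"
proof -
  have "(\<Prod>j\<in>UNIV - {i}. (z $ j) ^ raise i k j) = (\<Prod>j\<in>UNIV - {i}. (z $ j) ^ k j)"
    by (rule prod.cong) auto
  thus ?thesis
    by (simp add: monomial_def prod.remove[of UNIV i])
qed

lemma DA_weight_raise:
  fixes k :: "'m :: finite \<Rightarrow> nat"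
  shows "DA_weight (raise i k) = DA_weight k * (real (Suc (k i)) / real (Suc (\<Sum>j\<in>UNIV. k j)))"
proof -
  have "(\<Prod>j\<in>UNIV - {i}. fact (raise i k j) :: real) = (\<Prod>j\<in>UNIV - {i}. fact (k j))"
    by (rule prod.cong) auto
  moreover have "(\<Sum>j\<in>UNIV - {i}. raise i k j) = (\<Sum>j\<in>UNIV - {i}. k j)"
    by (rule sum.cong) auto
  ultimately show ?thesis
    unfolding DA_weight_def prod.remove[of UNIV i, OF finite UNIV_I] sum.remove[of UNIV i, OF finite UNIV_I]
    by (simp add: mult_ac)
qed

lemma DA_weight_raise_le: "DA_weight (raise i k) \<le> DA_weight k"
proof -
  have "k i \<le> (\<Sum>j\<in>UNIV. k j)"
    by (intro member_le_sum) auto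
  hence "real (Suc (k i)) / real (Suc (\<Sum>j\<in>UNIV. k j)) \<le> 1"
    by (simp del: of_nat_sum)
  thus ?thesis
    unfolding DA_weight_raise by (intro mult_left_le) auto
qed

lemma DA_weight_zero [simp]: "DA_weight (\<lambda>_. 0) = 1"
  by (simp add: DA_weight_def)

context hilbert
begin

text \<open>The partial sum of \<open>z\<^sub>i f\<close> over a finite set \<open>K\<close> of exponents is \<open>z\<^sub>i\<close> times the partial sum of
  \<open>f\<close> over the exponents that \<open>raise i\<close> moves into \<open>K\<close>; these preimages exhaust all exponents as
  \<open>K\<close> does.\<close>

lemma power_series_act:
  fixes f :: "complex ^ 'm :: finite \<Rightarrow> 'a"
  assumes f: "has_power_series H f a"
  shows "has_power_series H (act (DA_module H) i f) (shift_coeff i a)"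
  unfolding has_power_series_def
proof (intro conjI allI ballI)
  have a: "a k \<in> hcarrier H" for k
    using f by (simp add: has_power_series_def)
  show "shift_coeff i a k \<in> hcarrier H" for k
    using a by (simp add: shift_coeff_def)
  fix z :: "complex ^ 'm" assume z: "z \<in> ball 0 1"
  have fz: "f z \<in> hcarrier H"
    using f z by (simp add: has_power_series_def)
  thus "act (DA_module H) i f z \<in> hcarrier H"
    by (simp add: scale_mem)
  let ?s = "\<lambda>K. \<Sum>k\<in>K. monomial z k *\<^sub>C a k"
  have "hnorm H ((\<Sum>k\<in>K. monomial z k *\<^sub>C shift_coeff i a k) - act (DA_module H) i f z) =
      cmod (z $ i) * hnorm H (?s (raise i -` K) - f z)" if K: "finite K" for K
  proof -
    have "(\<Sum>k\<in>K. monomial z k *\<^sub>C shift_coeff i a k) =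
        (\<Sum>k\<in>raise i ` (raise i -` K). monomial z k *\<^sub>C shift_coeff i a k)"
      using K by (intro sum.mono_neutral_right) (auto simp: shift_coeff_outside)
    also have "\<dots> = (\<Sum>k\<in>raise i -` K. monomial z (raise i k) *\<^sub>C a k)"
      by (subst sum.reindex) (auto intro: inj_on_subset[OF inj_raise])
    also have "\<dots> = (z $ i) *\<^sub>C ?s (raise i -` K)"
      by (simp add: monomial_raise complex_vector.scale_sum_right scaleC_scaleC)
    finally show ?thesis
      using fz a by (simp add: norm_scale mem flip: complex_vector.scale_right_diff_distrib)
  qed
  hence "\<forall>\<^sub>F K in finite_subsets_at_top UNIV.
      cmod (z $ i) * hnorm H (?s (raise i -` K) - f z) =
      hnorm H ((\<Sum>k\<in>K. monomial z k *\<^sub>C shift_coeff i a k) - act (DA_module H) i f z)"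
    by (intro eventually_finite_subsets_at_top_weakI) simp
  moreover have "filterlim (\<lambda>K. raise i -` K) (finite_subsets_at_top UNIV) (finite_subsets_at_top UNIV)"
    unfolding filterlim_finite_subsets_at_top
  proof (intro allI impI)
    fix X :: "('m \<Rightarrow> nat) set" assume "finite X \<and> X \<subseteq> UNIV"
    thus "\<forall>\<^sub>F K in finite_subsets_at_top UNIV. finite (raise i -` K) \<and> X \<subseteq> raise i -` K \<and> raise i -` K \<subseteq> UNIV"
      unfolding eventually_finite_subsets_at_top
      by (intro exI[of _ "raise i ` X"]) (auto intro: finite_vimageI[OF _ inj_raise])
  qed
  hence "((\<lambda>K. hnorm H (?s (raise i -` K) - f z)) \<longlongrightarrow> 0) (finite_subsets_at_top UNIV)"
    by (rule filterlim_compose[rotated]) (use f z in \<open>simp add: has_power_series_def\<close>)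
  hence "((\<lambda>K. cmod (z $ i) * hnorm H (?s (raise i -` K) - f z)) \<longlongrightarrow> 0) (finite_subsets_at_top UNIV)"
    by (rule tendsto_mult_right_zero)
  ultimately show "((\<lambda>K. hnorm H ((\<Sum>k\<in>K. monomial z k *\<^sub>C shift_coeff i a k) -
      act (DA_module H) i f z)) \<longlongrightarrow> 0) (finite_subsets_at_top UNIV)"
    by (rule Lim_transform_eventually[rotated])
qed

lemma act_summable:
  fixes f :: "complex ^ 'm :: finite \<Rightarrow> 'a"
  assumes "f \<in> hcarrier (DA_module H)" "has_power_series H f a"
  shows "(\<lambda>k. DA_weight (raise i k) * (hnorm H (a k))\<^sup>2) summable_on UNIV"
  by (rule summable_on_comparison_test[OF DA_norm_summable[OF assms]])
    (auto intro: mult_right_mono DA_weight_raise_le)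

lemma DA_act_mem:
  fixes f :: "complex ^ 'm :: finite \<Rightarrow> 'a"
  assumes f: "f \<in> hcarrier (DA_module H)"
  shows "act (DA_module H) i f \<in> hcarrier (DA_module H)"
proof -
  obtain a where a: "has_power_series H f a"
    using f by (rule DA_carrierE)
  have "((\<lambda>k. DA_weight k * (hnorm H (shift_coeff i a k))\<^sup>2) \<circ> raise i) summable_on UNIV"
    using act_summable[OF f a] by (simp add: o_def)
  hence "(\<lambda>k. DA_weight k * (hnorm H (shift_coeff i a k))\<^sup>2) summable_on range (raise i)"
    by (rule summable_on_reindex[OF inj_raise, THEN iffD2])
  hence "(\<lambda>k. DA_weight k * (hnorm H (shift_coeff i a k))\<^sup>2) summable_on UNIV"
    by (rule summable_on_cong_neutral[THEN iffD1, rotated -1]) (auto simp: shift_coeff_outside)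
  thus ?thesis
    using f by (intro DA_carrierI[OF _ power_series_act[OF a]]) (simp_all add: DA_outside)
qed

lemma DA_norm_act:
  fixes f :: "complex ^ 'm :: finite \<Rightarrow> 'a"
  assumes f: "f \<in> hcarrier (DA_module H)" and a: "has_power_series H f a"
  shows "hnorm (DA_module H) (act (DA_module H) i f) =
    sqrt (\<Sum>\<^sub>\<infinity>k. DA_weight (raise i k) * (hnorm H (a k))\<^sup>2)"
proof -
  have "(\<Sum>\<^sub>\<infinity>k. DA_weight k * (hnorm H (shift_coeff i a k))\<^sup>2) =
      (\<Sum>\<^sub>\<infinity>k\<in>range (raise i). DA_weight k * (hnorm H (shift_coeff i a k))\<^sup>2)"
    by (rule infsum_cong_neutral) (auto simp: shift_coeff_outside)
  also have "\<dots> = (\<Sum>\<^sub>\<infinity>k. DA_weight (raise i k) * (hnorm H (a k))\<^sup>2)"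
    by (subst infsum_reindex[OF inj_raise]) (simp add: o_def)
  finally show ?thesis
    using DA_norm[OF DA_act_mem[OF f] power_series_act[OF a]] by simp
qed

lemma power_series_value_unique:
  fixes f g :: "complex ^ 'm :: finite \<Rightarrow> 'a"
  assumes f: "has_power_series H f a" and g: "has_power_series H g a" and z: "z \<in> ball 0 1"
  shows "f z = g z"
proof (rule norm_limit_unique[of "finite_subsets_at_top UNIV"])
  show "((\<lambda>K. hnorm H ((\<Sum>k\<in>K. monomial z k *\<^sub>C a k) - f z)) \<longlongrightarrow> 0) (finite_subsets_at_top UNIV)"
    "((\<lambda>K. hnorm H ((\<Sum>k\<in>K. monomial z k *\<^sub>C a k) - g z)) \<longlongrightarrow> 0) (finite_subsets_at_top UNIV)"
    "\<And>K. (\<Sum>k\<in>K. monomial z k *\<^sub>C a k) \<in> hcarrier H" "f z \<in> hcarrier H" "g z \<in> hcarrier H"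
    using f g z by (auto simp: has_power_series_def mem)
qed simp

text \<open>Multiplication by \<open>z\<^sub>i\<close> scales the weight of \<open>z\<^sup>k\<close> by \<open>(k\<^sub>i + 1) / (\<bar>k\<bar> + 1)\<close>, which is less
  than \<open>1\<close> unless \<open>k\<close> is supported at \<open>i\<close>. If no multiplication by a coordinate function
  decreases the norm and there are at least two variables, only the constant term survives.\<close>

lemma constant_if_acts_isometric:
  fixes f :: "complex ^ 'm :: finite \<Rightarrow> 'a"
  assumes card: "CARD('m) > 1" and f: "f \<in> hcarrier (DA_module H)"
    and iso: "\<And>i. hnorm (DA_module H) (act (DA_module H) i f) = hnorm (DA_module H) f"
    and z: "z \<in> ball 0 1"
  shows "f z = f 0"
proof -
  obtain a where a: "has_power_series H f a"
    using f by (rule DA_carrierE)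
  have aH: "a k \<in> hcarrier H" for k
    using a by (simp add: has_power_series_def)
  have zero: "a k = 0" if k: "k \<noteq> (\<lambda>_. 0)" for k
  proof -
    obtain j where j: "k j \<noteq> 0"
      using k by auto
    have "\<exists>i. i \<noteq> j"
    proof (rule ccontr)
      assume "\<nexists>i. i \<noteq> j"
      hence "(UNIV :: 'm set) = {j}"
        by auto
      hence "CARD('m) = card {j}"
        by (rule arg_cong)
      thus False
        using card by simp
    qed
    then obtain i where i: "i \<noteq> j"
      by blast
    (* The terms of the difference of the squared norms of f and of the i-th product. *)
    define d where "d k = DA_weight k * (hnorm H (a k))\<^sup>2 - DA_weight (raise i k) * (hnorm H (a k))\<^sup>2" for k
    have "(\<Sum>\<^sub>\<infinity>k. DA_weight (raise i k) * (hnorm H (a k))\<^sup>2) = (\<Sum>\<^sub>\<infinity>k. DA_weight k * (hnorm H (a k))\<^sup>2)"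
      using iso[of i] unfolding DA_norm_act[OF f a] DA_norm[OF f a] by simp
    hence "(d has_sum 0) UNIV"
      using has_sum_add[OF has_sum_infsum[OF DA_norm_summable[OF f a]]
          has_sum_uminusI[OF has_sum_infsum[OF act_summable[OF f a, of i]]]]
      by (simp add: d_def[abs_def])
    moreover have "d k \<ge> 0" for k
      using DA_weight_raise_le[of k i] by (simp add: d_def mult_right_mono)
    ultimately have "d k = 0"
      using nonneg_has_sum_le_0D[where f = d and A = UNIV and x = k and a = 0] by simp
    moreover have "DA_weight (raise i k) < DA_weight k"
    proof -
      have "k i + k j = (\<Sum>l\<in>{i, j}. k l)"
        using i by simp
      also have "\<dots> \<le> (\<Sum>l\<in>UNIV. k l)"
        by (intro sum_mono2) auto
      finally have "real (Suc (k i)) / real (Suc (\<Sum>l\<in>UNIV. k l)) < 1"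
        using j by (simp del: of_nat_sum)
      thus ?thesis
        unfolding DA_weight_raise
        using mult_strict_left_mono[OF _ DA_weight_pos[of k]] by fastforce
    qed
    ultimately have "hnorm H (a k) = 0"
      by (simp add: d_def flip: left_diff_distrib)
    thus ?thesis
      using aH by (simp add: norm_eq_zero)
  qed
  hence "a = (\<lambda>k. if k = (\<lambda>_. 0) then a (\<lambda>_. 0) else 0)"
    by auto
  hence "has_power_series H f (\<lambda>k. if k = (\<lambda>_. 0) then a (\<lambda>_. 0) else 0)"
    using a by simp
  from power_series_value_unique[OF this DA_monomial_power_series[OF aH]]
  have "f w = a (\<lambda>_. 0)" if "w \<in> ball 0 1" for w
    using that by (simp add: DA_monomial_def monomial_def scaleC_one)
  thus ?thesis
    using z by simp
qed

end


section \<open>Functions with values in a closed subspace\<close>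

text \<open>The module over \<open>G\<close> constrains the Taylor coefficients as well as the values. Multiplication by
  constants uses the values, orthogonality uses the coefficients, so both are kept.\<close>

lemma DA_subspace_iff:
  fixes f :: "complex ^ 'm :: finite \<Rightarrow> 'a :: complex_vector"
  assumes "closed_subspace H G" "hilbert_space H"
  shows "f \<in> hcarrier (DA_module (subhspace H G)) \<longleftrightarrow>
    f \<in> hcarrier (DA_module H) \<and> (\<forall>k. taylor_coeff H f k \<in> G) \<and> (\<forall>z\<in>ball 0 1. f z \<in> G)"
    (is "?L \<longleftrightarrow> ?R")
proof -
  interpret H: hilbert H by unfold_locales fact
  have G: "G \<subseteq> hcarrier H"
    using assms(1) by (simp add: closed_subspace_def)
  have series: "has_power_series (subhspace H G) f a \<longleftrightarrow>
      has_power_series H f a \<and> (\<forall>k. a k \<in> G) \<and> (\<forall>z\<in>ball 0 1. f z \<in> G)" for a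
    using G unfolding has_power_series_def by auto
  show ?thesis
  proof
    assume L: ?L
    then obtain a where a: "has_power_series (subhspace H G) f a"
      "(\<lambda>k. DA_weight k * (hnorm H (a k))\<^sup>2) summable_on UNIV"
      by (auto elim: DA_carrierE)
    have "f \<in> hcarrier (DA_module H)"
      using a L unfolding series by (intro DA_carrierI[of f H a]) (auto simp: DA_outside)
    moreover have "taylor_coeff H f = a"
      using a unfolding series by (intro H.taylor_coeff_eq) simp
    ultimately show ?R
      using a by (simp add: series)
  next
    assume R: ?R
    thus ?L
      using H.DA_taylor[of f]
      by (intro DA_carrierI[of f _ "taylor_coeff H f"]) (auto simp: series DA_outside)
  qed
qed

lemma (in hilbert) DA_orthogonal:
  fixes f g :: "complex ^ 'm :: finite \<Rightarrow> 'a"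
  assumes G: "closed_subspace H G"
    and f: "has_power_series H f a" "\<And>k. a k \<in> orthocomplement H G"
    and g: "g \<in> hcarrier (DA_module (subhspace H G))"
  shows "hinner (DA_module H) f g = 0"
proof -
  have g': "g \<in> hcarrier (DA_module H)" "taylor_coeff H g k \<in> G" for k
    using g by (simp_all add: DA_subspace_iff[OF G hilbert_space])
  show ?thesis
    unfolding DA_inner[OF f(1) DA_taylor(1)[OF g'(1)]]
    using f(2) g'(2) by (simp add: orthocomplement_def)
qed

text \<open>Testing against monomials with coefficients in \<open>G\<close> shows that the Taylor coefficients are
  orthogonal to \<open>G\<close>; the values inherit this as sums of the power series.\<close>

lemma (in hilbert) DA_orthocomplementI:
  fixes f :: "complex ^ 'm :: finite \<Rightarrow> 'a"
  assumes G: "closed_subspace H G" and f: "f \<in> hcarrier (DA_module H)"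
    and orth: "\<And>k x. x \<in> G \<Longrightarrow> hinner (DA_module H) (DA_monomial k x) f = 0"
  shows "f \<in> hcarrier (DA_module (subhspace H (orthocomplement H G)))"
proof -
  have GH: "G \<subseteq> hcarrier H"
    using G by (simp add: closed_subspace_def)
  let ?a = "taylor_coeff H f"
  have inner: "hinner H (?a k) x = 0" if "x \<in> G" for k x
  proof -
    have x: "x \<in> hcarrier H"
      using that GH by blast
    have "of_real (DA_weight k) * hinner H x (?a k) = 0"
      using orth[OF that, of k] unfolding DA_inner_monomial[OF x DA_taylor(1)[OF f]] .
    moreover have "DA_weight k \<noteq> 0"
      using DA_weight_pos[of k] by linarith
    ultimately show ?thesis
      using inner_commute[OF x DA_taylor(3)[OF f], of k] by simp
  qed
  have "hinner H (f z) x = 0" if "x \<in> G" "z \<in> ball 0 1" for x z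
  proof (rule has_sum_unique)
    show "((\<lambda>k. monomial z k * hinner H (?a k) x) has_sum hinner H (f z) x) UNIV"
      using has_power_series_inner[OF DA_taylor(1)[OF f] that(2)] that(1) GH by blast
    show "((\<lambda>k. monomial z k * hinner H (?a k) x) has_sum 0) UNIV"
      using inner[OF that(1)] by simp
  qed
  thus ?thesis
    using f inner DA_taylor(3)[OF f] DA_value[OF f]
    unfolding DA_subspace_iff[OF closed_subspace_orthocomplement[OF GH] hilbert_space]
    by (simp add: orthocomplement_def)
qed

lemma (in hilbert) DA_subspace_zero:
  "hcarrier (DA_module (subhspace H {0})) = {0 :: complex ^ 'm :: finite \<Rightarrow> 'a}"
proof -
  have "f = 0" if "f \<in> hcarrier (DA_module (subhspace H {0}))" for f :: "complex ^ 'm \<Rightarrow> 'a"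
  proof
    show "f z = 0 z" for z
      using DA_value[OF that, of z] DA_outside[OF that, of z] by (cases "z \<in> ball 0 1") auto
  qed
  moreover have "(0 :: complex ^ 'm \<Rightarrow> 'a) \<in> hcarrier (DA_module (subhspace H {0}))"
    by (rule DA_carrierI[where a = "\<lambda>_. 0"]) (simp_all add: has_power_series_def)
  ultimately show ?thesis
    by blast
qed


section \<open>Rigidity of inner multipliers\<close>

text \<open>For \<open>x\<close> orthogonal to \<open>G\<close>, the multiplier preserves the norms of the constant \<open>x\<close> and of its
  products with the coordinate functions, because all of these are orthogonal to the kernel. As the
  multiplier commutes with the coordinate functions, the image of the constant \<open>x\<close> keeps its norm
  under each of them, which forces it to be constant. On \<open>G\<close> the multiplier vanishes, and \<open>G\<close>
  together with its orthogonal complement spans the whole space.\<close>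

lemma inner_multiplier_constant:
  fixes \<phi> :: "complex ^ 'm :: finite \<Rightarrow> 'e :: complex_vector \<Rightarrow> 'f :: complex_vector"
  assumes card: "CARD('m) > 1" and E: "hilbert_space E" and F: "hilbert_space F"
    and \<phi>: "inner_multiplier E F \<phi>" and G: "closed_subspace E G"
    and ker: "hker (DA_module E) (mult_op \<phi>) = hcarrier (DA_module (subhspace E G))"
  shows "\<lbrakk>z \<in> ball 0 1; x \<in> hcarrier E\<rbrakk> \<Longrightarrow> \<phi> z x = \<phi> 0 x"
    and "x \<in> G \<Longrightarrow> \<phi> 0 x = 0"
    and "x \<in> orthocomplement E G \<Longrightarrow> hnorm F (\<phi> 0 x) = hnorm E x"
proof -
  interpret E: hilbert E by unfold_locales fact
  interpret F: hilbert F by unfold_locales fact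
  interpret G: hilbert "subhspace E G"
    using G by unfold_locales (simp add: closed_subspace_def)
  have GE: "G \<subseteq> hcarrier E"
    using G by (simp add: closed_subspace_def)
  let ?D = "DA_module E :: (complex ^ 'm \<Rightarrow> 'e, 'm) hmodule"
  let ?D' = "DA_module F :: (complex ^ 'm \<Rightarrow> 'f, 'm) hmodule"
  let ?X = "mult_op \<phi>"
  have bop: "bounded_op E F (\<phi> w)" if "w \<in> ball 0 1" for w
    using \<phi> that by (simp add: inner_multiplier_def multiplier_def op_holomorphic_def)
  have mem: "?X f \<in> hcarrier ?D'" if "f \<in> hcarrier ?D" for f
    using \<phi> that by (simp add: inner_multiplier_def multiplier_def)
  have iso: "hnorm ?D' (?X f) = hnorm ?D f"
    if "f \<in> hcarrier ?D" "has_power_series E f a" "\<And>k. a k \<in> orthocomplement E G" for f a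
  proof -
    have "\<forall>g\<in>hker ?D ?X. hinner ?D f g = 0"
      unfolding ker using E.DA_orthogonal[OF G that(2,3)] by blast
    thus ?thesis
      using \<phi> that(1) by (simp add: inner_multiplier_def partial_isometry_def)
  qed
  let ?c = "DA_monomial (\<lambda>_. 0) :: 'e \<Rightarrow> complex ^ 'm \<Rightarrow> 'e"
  have c: "?c x w = x" "?X (?c x) w = \<phi> w x" if "w \<in> ball 0 1" for x w
    using that by (simp_all add: DA_monomial_def mult_op_def monomial_def scaleC_one)
  have zero: "\<phi> w x = 0" if "x \<in> G" "w \<in> ball 0 1" for x w
  proof -
    have "?c x \<in> hcarrier (DA_module (subhspace E G))"
      using that by (intro G.DA_monomial_mem) simp
    hence "?X (?c x) = 0"
      by (simp add: hker_def flip: ker)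
    from fun_cong[OF this, of w] show ?thesis
      using c(2)[OF that(2), of x] by simp
  qed
  show "\<phi> 0 x = 0" if "x \<in> G"
    using zero[OF that] by simp
  have const: "?X (?c x) w = ?X (?c x) 0" if x: "x \<in> orthocomplement E G" and w: "w \<in> ball 0 1" for x w
  proof (rule F.constant_if_acts_isometric[OF card _ _ w])
    interpret P: hilbert "subhspace E (orthocomplement E G)"
      using E.closed_subspace_orthocomplement[OF GE] by unfold_locales (simp add: closed_subspace_def)
    have xE: "x \<in> hcarrier E"
      using x by (simp add: orthocomplement_def)
    let ?a = "\<lambda>k. if k = (\<lambda>_. 0) then x else 0"
    have a: "has_power_series E (?c x) ?a"
      by (rule E.DA_monomial_power_series[OF xE])
    have aG: "?a k \<in> orthocomplement E G" for k
      using x P.zero_mem by simp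
    have cx: "?c x \<in> hcarrier ?D"
      by (rule E.DA_monomial_mem[OF xE])
    show "?X (?c x) \<in> hcarrier ?D'"
      by (rule mem[OF cx])
    fix i
    have "act ?D' i (?X (?c x)) = ?X (act ?D i (?c x))"
    proof
      show "act ?D' i (?X (?c x)) w = ?X (act ?D i (?c x)) w" for w
        using bop[of w] xE c(1)[of w x] by (simp add: mult_op_def bounded_op_def)
    qed
    moreover have "shift_coeff i ?a k \<in> orthocomplement E G" for k
      using x P.zero_mem by (auto simp: shift_coeff_def)
    ultimately have "hnorm ?D' (act ?D' i (?X (?c x))) = hnorm ?D (act ?D i (?c x))"
      using iso[OF E.DA_act_mem[OF cx] E.power_series_act[OF a]] by simp
    also have "\<dots> = hnorm ?D (?c x)"
    proof -
      have "((\<lambda>k. DA_weight (raise i k) * (hnorm E (?a k))\<^sup>2) has_sum (hnorm E x)\<^sup>2) UNIV"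
        using DA_weight_raise[of "\<lambda>_ :: 'm. 0" i]
        by (intro has_sum_finite_neutralI[of "{\<lambda>_. 0}"]) auto
      hence "(\<Sum>\<^sub>\<infinity>k. DA_weight (raise i k) * (hnorm E (?a k))\<^sup>2) = (hnorm E x)\<^sup>2"
        by (rule infsumI)
      thus ?thesis
        using E.DA_norm_act[OF cx a, of i] E.DA_norm_monomial[OF xE, of "\<lambda>_ :: 'm. 0"] xE
        by simp
    qed
    also have "\<dots> = hnorm ?D' (?X (?c x))"
      by (rule iso[OF cx a aG, symmetric])
    finally show "hnorm ?D' (act ?D' i (?X (?c x))) = hnorm ?D' (?X (?c x))" .
  qed
  have const': "\<phi> w x = \<phi> 0 x" if "x \<in> orthocomplement E G" "w \<in> ball 0 1" for x w
    using const[OF that] c(2)[OF that(2), of x] c(2)[of 0 x] by simp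
  show "\<phi> z x = \<phi> 0 x" if z: "z \<in> ball 0 1" and x: "x \<in> hcarrier E"
  proof -
    obtain g h where gh: "g \<in> G" "h \<in> orthocomplement E G" "x = g + h"
      using E.orthogonal_decomposition[OF G x] .
    have E': "g \<in> hcarrier E" "h \<in> hcarrier E"
      using gh GE by (auto simp: orthocomplement_def)
    hence "\<phi> w x = \<phi> w h" if "w \<in> ball 0 1" for w
      using bop[OF that] zero[OF gh(1) that] by (simp add: gh(3) bounded_op_def)
    thus ?thesis
      using const'[OF gh(2) z] z by simp
  qed
  show "hnorm F (\<phi> 0 x) = hnorm E x" if x: "x \<in> orthocomplement E G"
  proof -
    have xE: "x \<in> hcarrier E"
      using x by (simp add: orthocomplement_def)
    interpret P: hilbert "subhspace E (orthocomplement E G)"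
      using E.closed_subspace_orthocomplement[OF GE] by unfold_locales (simp add: closed_subspace_def)
    have "?X (?c x) = DA_monomial (\<lambda>_. 0) (\<phi> 0 x)"
    proof
      show "?X (?c x) w = DA_monomial (\<lambda>_. 0) (\<phi> 0 x) w" for w
        using const'[OF x, of w] c(2)[of w x]
        by (cases "w \<in> ball 0 1") (simp_all add: DA_monomial_def monomial_def mult_op_def scaleC_one)
    qed
    moreover have "hnorm ?D' (?X (?c x)) = hnorm ?D (?c x)"
      using x P.zero_mem
      by (intro iso[OF E.DA_monomial_mem[OF xE] E.DA_monomial_power_series[OF xE]]) simp
    moreover have "\<phi> 0 x \<in> hcarrier F"
      using bop[of 0] xE by (simp add: bounded_op_def)
    ultimately show ?thesis
      using F.DA_norm_monomial[of "\<phi> 0 x" "\<lambda>_ :: 'm. 0"] E.DA_norm_monomial[OF xE, of "\<lambda>_ :: 'm. 0"]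
      by simp
  qed
qed

text \<open>The multiplier acts as the constant \<open>V = \<phi> 0\<close>, which maps the orthogonal complement \<open>P\<close> of \<open>G\<close>
  isometrically onto a closed subspace. A function with values there is lifted through the inverse
  of this isometry, so that no convergence of the lifted series has to be established anew.\<close>

lemma inner_multiplier_range:
  fixes \<phi> :: "complex ^ 'm :: finite \<Rightarrow> 'e :: complex_vector \<Rightarrow> 'f :: complex_vector"
  assumes card: "CARD('m) > 1" and E: "hilbert_space E" and F: "hilbert_space F"
    and \<phi>: "inner_multiplier E F \<phi>" and G: "closed_subspace E G"
    and ker: "hker (DA_module E) (mult_op \<phi>) = hcarrier (DA_module (subhspace E G))"
  shows "\<exists>G'. closed_subspace F G' \<and>
    hran (DA_module E) (mult_op \<phi>) = hcarrier (DA_module (subhspace F G'))"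
proof -
  interpret E: hilbert E by unfold_locales fact
  note \<phi>_const = inner_multiplier_constant[OF card E F \<phi> G ker]
  let ?V = "\<phi> 0"
  define P where "P = orthocomplement E G"
  have GE: "G \<subseteq> hcarrier E"
    using G by (simp add: closed_subspace_def)
  have P: "closed_subspace E P"
    unfolding P_def by (rule E.closed_subspace_orthocomplement[OF GE])
  hence PE: "P \<subseteq> hcarrier E" and PH: "hilbert_space (subhspace E P)"
    by (simp_all add: closed_subspace_def)
  have V: "bounded_op E F ?V"
    using \<phi> by (simp add: inner_multiplier_def multiplier_def op_holomorphic_def)
  hence VP: "bounded_op (subhspace E P) F ?V"
    using PE unfolding bounded_op_def subhspace_simps by blast
  define G' where "G' = ?V ` P"
  have norm: "hnorm F (?V x) = hnorm (subhspace E P) x" if "x \<in> hcarrier (subhspace E P)" for x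
    using \<phi>_const(3) that by (simp add: P_def)
  note J = isometric_image[OF PH F VP norm, simplified, folded G'_def]
  have G'F: "hilbert_space (subhspace F G')"
    using J(1) by (simp add: closed_subspace_def)
  have "?V x \<in> G'" if x: "x \<in> hcarrier E" for x
  proof -
    obtain g h where gh: "g \<in> G" "h \<in> P" "x = g + h"
      using E.orthogonal_decomposition[OF G x] unfolding P_def .
    have "?V x = ?V g + ?V h"
      using V gh GE PE unfolding bounded_op_def by blast
    thus ?thesis
      using \<phi>_const(2)[OF gh(1)] gh(2) by (simp add: G'_def)
  qed
  hence VE: "bounded_op E (subhspace F G') ?V"
    using V by (simp add: bounded_op_def)
  have X: "mult_op \<phi> f = mult_op (\<lambda>_. ?V) f" if "f \<in> hcarrier (DA_module E)" for f
  proof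
    show "mult_op \<phi> f z = mult_op (\<lambda>_. ?V) f z" for z
      using \<phi>_const(1)[of z "f z"] DA_value[OF that, of z] by (simp add: mult_op_def)
  qed
  have "hran (DA_module E) (mult_op \<phi>) = hcarrier (DA_module (subhspace F G'))"
  proof
    show "hran (DA_module E) (mult_op \<phi>) \<subseteq> hcarrier (DA_module (subhspace F G'))"
      using DA_const_mult[OF E G'F VE] X by (auto simp: hran_def)
    show "hcarrier (DA_module (subhspace F G')) \<subseteq> hran (DA_module E) (mult_op \<phi>)"
    proof
      fix f :: "complex ^ 'm \<Rightarrow> 'f" assume f: "f \<in> hcarrier (DA_module (subhspace F G'))"
      define g where "g = mult_op (\<lambda>_. inv_into P ?V) f"
      have "g \<in> hcarrier (DA_module (subhspace E P))"
        unfolding g_def by (rule DA_const_mult[OF G'F PH J(3) f])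
      hence g: "g \<in> hcarrier (DA_module E)"
        by (simp add: DA_subspace_iff[OF P E])
      have "mult_op (\<lambda>_. ?V) g = f"
      proof
        show "mult_op (\<lambda>_. ?V) g z = f z" for z
          using DA_value[OF f, of z] DA_outside[OF f, of z]
          by (auto simp: mult_op_def g_def G'_def f_inv_into_f)
      qed
      thus "f \<in> hran (DA_module E) (mult_op \<phi>)"
        using g X[OF g] unfolding hran_def by (metis image_eqI)
    qed
  qed
  thus ?thesis
    using J(1) by blast
qed

text \<open>The induction runs from the last term of the resolution, whose kernel is zero, down to the first
  one; the last step to \<open>X\<^sub>0\<close> is separate because \<open>X\<^sub>0\<close> is not given by a multiplier.\<close>

lemma finite_inner_resolution_kernel:
  fixes M :: "('a :: complex_vector, 'm :: finite) hmodule"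
    and E :: "nat \<Rightarrow> 'e :: complex_vector hspace"
  assumes card: "CARD('m) > 1" and res: "finite_inner_resolution M N E \<phi> X0"
  shows "\<exists>G. closed_subspace (E 0) G \<and>
    hker (DA_module (E 0)) X0 = hcarrier (DA_module (subhspace (E 0) G))"
proof -
  have N: "1 \<le> N"
    and E: "\<And>k. k \<le> N \<Longrightarrow> hilbert_space (E k)"
    and \<phi>: "\<And>k. \<lbrakk>1 \<le> k; k \<le> N\<rbrakk> \<Longrightarrow> inner_multiplier (E k) (E (k - 1)) (\<phi> k)"
    and exact0: "hran (DA_module (E 1)) (mult_op (\<phi> 1)) = hker (DA_module (E 0)) X0"
    and exact: "\<And>k. \<lbrakk>2 \<le> k; k \<le> N\<rbrakk> \<Longrightarrow> hran (DA_module (E k)) (mult_op (\<phi> k)) =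
      hker (DA_module (E (k - 1))) (mult_op (\<phi> (k - 1)))"
    and exactN: "hker (DA_module (E N)) (mult_op (\<phi> N)) = {0}"
    using res unfolding finite_inner_resolution_def by auto
  have "\<exists>G. closed_subspace (E 1) G \<and>
      hker (DA_module (E 1)) (mult_op (\<phi> 1)) = hcarrier (DA_module (subhspace (E 1) G))"
    using N
  proof (induction rule: inc_induct)
    case base
    interpret hilbert "E N"
      using E by unfold_locales simp
    show ?case
      using closed_subspace_zero DA_subspace_zero exactN by metis
  next
    case (step n)
    then obtain G where G: "closed_subspace (E (Suc n)) G"
      "hker (DA_module (E (Suc n))) (mult_op (\<phi> (Suc n))) = hcarrier (DA_module (subhspace (E (Suc n)) G))"
      by blast
    show ?case
      using inner_multiplier_range[OF card E E _ G, of n] \<phi>[of "Suc n"] exact[of "Suc n"] step.hyps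
      by simp
  qed
  then obtain G where G: "closed_subspace (E 1) G"
    "hker (DA_module (E 1)) (mult_op (\<phi> 1)) = hcarrier (DA_module (subhspace (E 1) G))"
    by blast
  show ?thesis
    using inner_multiplier_range[OF card E E _ G, of 0] \<phi>[of 1] N exact0 by simp
qed


section \<open>Co-isometric images\<close>

text \<open>The functions with values in the orthogonal complement \<open>P\<close> of \<open>G\<close> form a Drury-Arveson module
  \<open>L\<close>, on which \<open>X\<close> is inverted by its adjoint \<open>S\<close>: the range of \<open>S\<close> is orthogonal to the kernel of
  \<open>X\<close>, hence in \<open>L\<close>, and \<open>S X f - f\<close> lies in both \<open>L\<close> and the kernel for \<open>f\<close> in \<open>L\<close>. Since \<open>X\<close> is a module
  map, so is its inverse \<open>S\<close>. It remains to move the coefficients from \<open>P\<close> into \<open>M\<close>, by the isometry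
  \<open>J\<close> that applies \<open>X\<close> to constant functions.\<close>

lemma co_isometry_free:
  fixes M :: "('a :: complex_vector, 'm :: finite) hmodule"
    and E :: "('e :: complex_vector, 'x) hspace_scheme"
  assumes M: "hilbert_module M" and E: "hilbert_space E"
    and map: "module_map (DA_module E) M X" and co: "co_isometry (DA_module E) M X"
    and G: "closed_subspace E G"
    and ker: "hker (DA_module E) X = hcarrier (DA_module (subhspace E G))"
  shows "\<exists>F :: 'a hspace. hilbert_space F \<and> isometrically_isomorphic M (DA_module F)"
proof -
  have MH: "hilbert_space M"
    using M by (simp add: hilbert_module_def)
  interpret M: hilbert M by unfold_locales fact
  interpret E: hilbert E by unfold_locales fact
  interpret G: hilbert "subhspace E G"
    using G by unfold_locales (simp add: closed_subspace_def)
  let ?D = "DA_module E :: (complex ^ 'm \<Rightarrow> 'e, 'm) hmodule"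
  have GE: "G \<subseteq> hcarrier E"
    using G by (simp add: closed_subspace_def)
  define P where "P = orthocomplement E G"
  define H where "H = subhspace E P"
  have P: "closed_subspace E P"
    unfolding P_def by (rule E.closed_subspace_orthocomplement[OF GE])
  hence PE: "P \<subseteq> hcarrier E" and HH: "hilbert_space H"
    by (simp_all add: closed_subspace_def H_def)
  interpret H: hilbert H by unfold_locales fact
  have H_simps: "hcarrier H = P" "hinner H = hinner E" "hnorm H = hnorm E"
    by (simp_all add: H_def)
  let ?L = "DA_module H :: (complex ^ 'm \<Rightarrow> 'e, 'm) hmodule"
  have LD: "f \<in> hcarrier ?D" if "f \<in> hcarrier ?L" for f
    using that by (simp add: DA_subspace_iff[OF P E] H_def)
  have X: "X f \<in> hcarrier M" "X (c *\<^sub>C f) = c *\<^sub>C X f" "X (act ?D i f) = act M i (X f)"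
    if "f \<in> hcarrier ?D" for f c i
    using map that by (auto simp: module_map_def bounded_op_def)
  have X_add: "X (f + g) = X f + X g" if "f \<in> hcarrier ?D" "g \<in> hcarrier ?D" for f g
    using map that by (auto simp: module_map_def bounded_op_def)
  have X_diff: "X (f - g) = X f - X g" if "f \<in> hcarrier ?D" "g \<in> hcarrier ?D" for f g
    using X_add[OF E.DA_diff[OF that] that(2)] by simp
  obtain S where S: "\<And>y. y \<in> hcarrier M \<Longrightarrow> S y \<in> hcarrier ?D"
    and adj: "\<And>f y. f \<in> hcarrier ?D \<Longrightarrow> y \<in> hcarrier M \<Longrightarrow> hinner M (X f) y = hinner ?D f (S y)"
    and XS: "\<And>y. y \<in> hcarrier M \<Longrightarrow> X (S y) = y"
    using co unfolding co_isometry_def has_adjoint_def by blast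
  have SL: "S y \<in> hcarrier ?L" if y: "y \<in> hcarrier M" for y
    unfolding H_def P_def
  proof (rule E.DA_orthocomplementI[OF G S[OF y]])
    fix k :: "'m \<Rightarrow> nat" and x assume x: "x \<in> G"
    have "DA_monomial k x \<in> hker ?D X"
      unfolding ker using x by (intro G.DA_monomial_mem) simp
    hence "DA_monomial k x \<in> hcarrier ?D" "X (DA_monomial k x) = 0"
      by (simp_all add: hker_def)
    thus "hinner ?D (DA_monomial k x) (S y) = 0"
      using adj[OF _ y] y by (metis M.inner_zero_left)
  qed
  have SX: "S (X f) = f" if f: "f \<in> hcarrier ?L" for f
  proof -
    note Xf = X(1)[OF LD[OF f]]
    define d where "d = S (X f) - f"
    have "d \<in> hker ?D X"
      using S[OF Xf] XS[OF Xf] LD[OF f] by (simp add: hker_def d_def X_diff E.DA_diff)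
    hence dG: "d \<in> hcarrier (DA_module (subhspace E G))"
      by (simp add: ker)
    have dP: "d \<in> hcarrier ?L"
      unfolding d_def by (rule H.DA_diff[OF SL[OF Xf] f])
    have "d z = 0" for z
    proof (cases "z \<in> ball 0 1")
      case True
      thus ?thesis
        using DA_value[OF dG True] DA_value[OF dP True] E.orthocomplement_disjoint[of "d z" G]
        by (simp add: H_simps P_def)
    next
      case False
      thus ?thesis by (rule DA_outside[OF dG])
    qed
    hence "d = 0"
      by auto
    thus ?thesis
      by (simp add: d_def)
  qed
  have S_add: "S (x + y) = S x + S y" if "x \<in> hcarrier M" "y \<in> hcarrier M" for x y
    using SX[OF H.DA_add[OF SL[OF that(1)] SL[OF that(2)]]] that by (simp add: X_add S XS)
  have S_scale: "S (c *\<^sub>C x) = c *\<^sub>C S x" if "x \<in> hcarrier M" for c x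
    using SX[OF H.DA_scale[OF SL[OF that], of c]] that by (simp add: X(2)[OF S] XS)
  have act_HE: "act ?L i f = act ?D i f" for i f
    by (simp add: DA_module_def)
  have S_act: "S (act M i x) = act ?D i (S x)" if "x \<in> hcarrier M" for i x
    using SX[OF H.DA_act_mem[OF SL[OF that], of i]] that by (simp add: X(3)[OF S] XS act_HE)

  define J where "J h = X (DA_monomial (\<lambda>_. 0) h)" for h
  let ?c = "DA_monomial (\<lambda>_. 0) :: 'e \<Rightarrow> complex ^ 'm \<Rightarrow> 'e"
  have cL: "?c h \<in> hcarrier ?L" if "h \<in> P" for h
    using that by (intro H.DA_monomial_mem) (simp add: H_simps)
  have J_inner: "hinner M (J h) (J h') = hinner E h h'" if h: "h \<in> P" "h' \<in> P" for h h'
  proof -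
    have "hinner M (J h) (J h') = hinner ?D (?c h) (?c h')"
      unfolding J_def
      using adj[OF LD[OF cL[OF h(1)]] X(1)[OF LD[OF cL[OF h(2)]]]] by (simp only: SX[OF cL[OF h(2)]])
    also have "\<dots> = hinner E h h'"
      using E.DA_inner_monomial[OF _ E.DA_monomial_power_series, of h h' "\<lambda>_. 0" "\<lambda>_. 0"] h PE
      by (auto simp: subset_iff)
    finally show ?thesis .
  qed
  have J_norm: "hnorm M (J h) = hnorm H h" if "h \<in> hcarrier H" for h
    using J_inner that by (simp add: hnorm_def H_simps)
  have J: "bounded_op H M J"
    unfolding bounded_op_def
  proof (intro conjI ballI allI exI[of _ 1])
    fix c x y assume xy: "x \<in> hcarrier H" "y \<in> hcarrier H"
    have "?c (x + y) = ?c x + ?c y" "?c (c *\<^sub>C x) = c *\<^sub>C ?c x"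
      by (auto simp: DA_monomial_def fun_eq_iff scaleC_fun_def monomial_def scaleC_one)
    thus "J (x + y) = J x + J y" "J (c *\<^sub>C x) = c *\<^sub>C J x"
      unfolding J_def using xy by (simp_all add: X_add X(2) cL LD H_simps)
    show "J x \<in> hcarrier M"
      unfolding J_def using xy by (simp add: X(1) cL LD H_simps)
  qed (simp add: J_norm)
  define F where "F = subhspace M (J ` P)"
  note im = isometric_image[OF HH MH J J_norm, unfolded H_simps]
  have F: "hilbert_space F"
    using im(1) by (simp add: closed_subspace_def F_def)
  interpret F: hilbert F by unfold_locales fact
  have J_inv: "bounded_op F H (inv_into P J)"
    using im(3) by (simp add: F_def)
  have JF: "bounded_op H F J"
    using J by (simp add: bounded_op_def F_def H_simps)
  let ?DF = "DA_module F :: (complex ^ 'm \<Rightarrow> 'a, 'm) hmodule"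
  define U where "U x = mult_op (\<lambda>_. J) (S x)" for x
  have U_inner: "hinner ?DF (U x) (U y) = hinner M x y" if x: "x \<in> hcarrier M" and y: "y \<in> hcarrier M" for x y
  proof -
    note tS = H.DA_taylor[OF SL[OF x]] H.DA_taylor[OF SL[OF y]]
    have tP: "taylor_coeff H (S x) k \<in> P" "taylor_coeff H (S y) k \<in> P" for k
      using tS(3,6) by (simp_all add: H_simps)
    have tE: "has_power_series E (S x) (taylor_coeff H (S x))" "has_power_series E (S y) (taylor_coeff H (S y))"
      using tS(1,4) PE unfolding has_power_series_def H_simps by auto
    have "hinner ?DF (U x) (U y) =
        (\<Sum>\<^sub>\<infinity>k. of_real (DA_weight k) * hinner F (J (taylor_coeff H (S x) k)) (J (taylor_coeff H (S y) k)))"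
      unfolding U_def by (intro F.DA_inner power_series_const_mult[OF HH F JF] tS)
    also have "\<dots> = hinner ?D (S x) (S y)"
      unfolding E.DA_inner[OF tE] using J_inner tP by (simp add: F_def)
    also have "\<dots> = hinner M x y"
      using adj[OF S[OF x] y] XS[OF x] by simp
    finally show ?thesis .
  qed
  have U_bounded: "bounded_op M ?DF U"
    unfolding bounded_op_def
  proof (intro conjI ballI allI exI[of _ 1])
    fix c x y assume x: "x \<in> hcarrier M" and y: "y \<in> hcarrier M"
    show "U x \<in> hcarrier ?DF"
      unfolding U_def by (rule DA_const_mult[OF HH F JF SL[OF x]])
    have val: "S x z \<in> hcarrier H" "S y z \<in> hcarrier H" if "z \<in> ball 0 1" for z
      using DA_value[OF SL that] x y by blast+
    show "U (x + y) = U x + U y"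
      using J val by (auto simp: U_def S_add[OF x y] mult_op_def fun_eq_iff bounded_op_def)
    show "U (c *\<^sub>C x) = c *\<^sub>C U x"
      using J val by (auto simp: U_def S_scale[OF x] mult_op_def fun_eq_iff scaleC_fun_def bounded_op_def)
    show "hnorm ?DF (U x) \<le> 1 * hnorm M x"
      using U_inner[OF x x] by (simp add: hnorm_def[of ?DF] hnorm_def[of M])
  qed
  have U_act: "U (act M i x) = act ?DF i (U x)" if x: "x \<in> hcarrier M" for i x
  proof
    show "U (act M i x) z = act ?DF i (U x) z" for z
      using DA_value[OF SL[OF x], of z] J by (auto simp: U_def S_act[OF x] mult_op_def bounded_op_def)
  qed
  have U_onto: "hran M U = hcarrier ?DF"
  proof
    show "hran M U \<subseteq> hcarrier ?DF"
      using U_bounded by (auto simp: hran_def bounded_op_def)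
    show "hcarrier ?DF \<subseteq> hran M U"
    proof
      fix g assume g: "g \<in> hcarrier ?DF"
      define f where "f = mult_op (\<lambda>_. inv_into P J) g"
      have f: "f \<in> hcarrier ?L"
        unfolding f_def by (rule DA_const_mult[OF F HH J_inv g])
      have "mult_op (\<lambda>_. J) f z = g z" for z
        using DA_value[OF g, of z] DA_outside[OF g, of z]
        by (auto simp: f_def mult_op_def F_def f_inv_into_f)
      hence "U (X f) = g"
        by (auto simp: U_def SX[OF f])
      thus "g \<in> hran M U"
        using X(1)[OF LD[OF f]] by (auto simp: hran_def)
    qed
  qed
  have "isometrically_isomorphic M ?DF"
    unfolding isometrically_isomorphic_def module_map_def unitary_op_def
    using U_bounded U_act U_onto U_inner by blast
  thus ?thesis
    using F by blast
qed

theorem theorem4p3: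
  fixes M :: "('a :: complex_vector, 'm :: finite) hmodule"
    and N :: nat
    and E :: "nat \<Rightarrow> 'e :: complex_vector hspace"
    and \<phi> :: "nat \<Rightarrow> complex ^ 'm \<Rightarrow> 'e \<Rightarrow> 'e"
    and X0 :: "(complex ^ 'm \<Rightarrow> 'e) \<Rightarrow> 'a"
  assumes "CARD('m) > 1"
    and "hilbert_module M"
    and "co_spherically_contractive M"
    and "pure_module M"
    and "finite_inner_resolution M N E \<phi> X0"
  shows "\<exists>F :: 'a hspace. hilbert_space F \<and> isometrically_isomorphic M (DA_module F)"
proof -
  obtain G where "closed_subspace (E 0) G"
    "hker (DA_module (E 0)) X0 = hcarrier (DA_module (subhspace (E 0) G))"
    using finite_inner_resolution_kernel[OF assms(1,5)] by blast
  moreover have "hilbert_space (E 0)" "module_map (DA_module (E 0)) M X0"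
    "co_isometry (DA_module (E 0)) M X0"
    using assms(5) by (simp_all add: finite_inner_resolution_def)
  ultimately show ?thesis
    using co_isometry_free[OF assms(2)] by blast
qed

end
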